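(* Let $p$ be a prime and $d\ge 2$. Then the restricted wreath product $G_{p,d}=C_p\wr X$, where $C_p$ is cyclic of order $p$ and $X$ is a free abelian group of rank $d$, does not admit a faithful state-closed representation of degree $p$.
   Context: The restricted wreath product $C_p\wr X$ is the semidirect product $A\rtimes X$ with $A=\bigoplus_{w\in X}C_p$, where $X$ permutes the summands regularly. For $m\ge 2$, the $1$-rooted regular $m$-ary tree $T_m$ has as vertices the finite sequences over $\{0,1,\dots,m-1\}$. Every automorphism $g$ of $T_m$ is written $g=(g_0,g_1,\dots,g_{m-1})\sigma$, where $\sigma$ is the permutation of $\{0,\dots,m-1\}$ induced by $g$ on the first level and $g_i\in\mathrm{Aut}(T_m)$ is determined by: $g$ maps the vertex $iw$ to $i^{\sigma}\,w^{g_i}$. The states of $g$ are $g$ itself, the $g_i$, the states of the $g_i$, and so on. A subgroup of $\mathrm{Aut}(T_m)$ is state-closed (self-similar) if it contains all states of each of its elements. A state-closed representation of degree $m$ of a group $G$ is a homomorphism $G\to\mathrm{Aut}(T_m)$ whose image is state-closed; it is faithful if it is injective. *)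

theory Defs
  imports "HOL-Algebra.Free_Abelian_Groups" "HOL-Algebra.Bij" "HOL-Computational_Algebra.Primes"
begin

section \<open>Restricted wreath products\<close>

text \<open>
  The semidirect product for a left action \<open>\<theta>\<close> of \<open>H\<close> on \<open>N\<close>,
  meant to be used with \<open>\<theta> \<in> hom H (AutoGroup N)\<close>.
\<close>

definition semidirect_product ::
    "('a, 'b) monoid_scheme \<Rightarrow> ('c, 'd) monoid_scheme \<Rightarrow> ('c \<Rightarrow> 'a \<Rightarrow> 'a) \<Rightarrow> ('a \<times> 'c) monoid"
  where "semidirect_product N H \<theta> =
    \<lparr>carrier = carrier N \<times> carrier H,
     monoid.mult = (\<lambda>(n, h) (n', h'). (n \<otimes>\<^bsub>N\<^esub> \<theta> h n', h \<otimes>\<^bsub>H\<^esub> h')),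
     one = (\<one>\<^bsub>N\<^esub>, \<one>\<^bsub>H\<^esub>)\<rparr>"

text \<open>
  The element \<open>x\<close> sends the summand with index \<open>w\<close> to the summand with index \<open>x w\<close>;
  on functions this is the substitution of \<open>x\<^sup>-\<^sup>1 w\<close> for the argument \<open>w\<close>.
\<close>

definition shift_action ::
    "('a, 'b) monoid_scheme \<Rightarrow> ('c, 'd) monoid_scheme \<Rightarrow> 'c \<Rightarrow> ('c \<Rightarrow> 'a) \<Rightarrow> ('c \<Rightarrow> 'a)"
  where "shift_action C Q x =
    (\<lambda>a \<in> carrier (sum_group (carrier Q) (\<lambda>_. C)). \<lambda>w \<in> carrier Q. a (inv\<^bsub>Q\<^esub> x \<otimes>\<^bsub>Q\<^esub> w))"

definition restricted_wreath_product ::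
    "('a, 'b) monoid_scheme \<Rightarrow> ('c, 'd) monoid_scheme \<Rightarrow> (('c \<Rightarrow> 'a) \<times> 'c) monoid"
  where "restricted_wreath_product C Q =
    semidirect_product (sum_group (carrier Q) (\<lambda>_. C)) Q (shift_action C Q)"

lemma group_semidirect_product:
  assumes N: "group N" and H: "group H" and \<theta>: "\<theta> \<in> hom H (AutoGroup N)"
  shows "group (semidirect_product N H \<theta>)"
proof -
  interpret N: group N by (rule N)
  interpret H: group H by (rule H)
  interpret \<theta>: group_hom H "AutoGroup N" \<theta>
    by (simp add: group_hom_def group_hom_axioms_def N.AutoGroup \<theta> H)
  have au: "\<theta> h \<in> auto N" if "h \<in> carrier H" for h
    using \<theta>.hom_closed[OF that] by (simp add: AutoGroup_def)
  have cl: "\<theta> h n \<in> carrier N" if "h \<in> carrier H" "n \<in> carrier N" for h n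
    using au[OF that(1)] that by (auto simp: auto_def hom_def)
  have mu: "\<theta> h (n \<otimes>\<^bsub>N\<^esub> n') = \<theta> h n \<otimes>\<^bsub>N\<^esub> \<theta> h n'"
    if "h \<in> carrier H" "n \<in> carrier N" "n' \<in> carrier N" for h n n'
    using au[OF that(1)] that by (auto simp: auto_def hom_def)
  have comp: "\<theta> (h \<otimes>\<^bsub>H\<^esub> h') n = \<theta> h (\<theta> h' n)"
    if "h \<in> carrier H" "h' \<in> carrier H" "n \<in> carrier N" for h h' n
    using \<theta>.hom_mult[OF that(1,2)] au[OF that(1)] au[OF that(2)] that(3)
    by (simp add: AutoGroup_def BijGroup_def auto_def compose_def)
  have id: "\<theta> \<one>\<^bsub>H\<^esub> n = n" if "n \<in> carrier N" for n
    using \<theta>.hom_one that by (simp add: AutoGroup_def BijGroup_def)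
  show ?thesis
  proof (rule groupI)
    fix x assume "x \<in> carrier (semidirect_product N H \<theta>)"
    then obtain n h where x: "x = (n, h)" "n \<in> carrier N" "h \<in> carrier H"
      by (auto simp: semidirect_product_def)
    let ?y = "(\<theta> (inv\<^bsub>H\<^esub> h) (inv\<^bsub>N\<^esub> n), inv\<^bsub>H\<^esub> h)"
    have one: "\<theta> h' \<one>\<^bsub>N\<^esub> = \<one>\<^bsub>N\<^esub>" if "h' \<in> carrier H" for h'
      using mu[OF that N.one_closed N.one_closed] cl[OF that N.one_closed]
      by (metis N.l_one N.one_closed N.r_cancel_one')
    have "?y \<otimes>\<^bsub>semidirect_product N H \<theta>\<^esub> x = \<one>\<^bsub>semidirect_product N H \<theta>\<^esub>"
      using x by (simp add: semidirect_product_def mu[symmetric] one del: \<theta>.hom_inv)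
    moreover have "?y \<in> carrier (semidirect_product N H \<theta>)"
      using x by (simp add: semidirect_product_def cl del: \<theta>.hom_inv)
    ultimately show "\<exists>y \<in> carrier (semidirect_product N H \<theta>).
        y \<otimes>\<^bsub>semidirect_product N H \<theta>\<^esub> x = \<one>\<^bsub>semidirect_product N H \<theta>\<^esub>"
      by blast
  qed (auto simp: semidirect_product_def cl mu comp id N.m_assoc H.m_assoc
      simp del: \<theta>.hom_mult \<theta>.hom_one)
qed

lemma shift_action_hom:
  assumes C: "group C" and Q: "group Q"
  shows "shift_action C Q \<in> hom Q (AutoGroup (sum_group (carrier Q) (\<lambda>_. C)))"
proof -
  interpret C: group C by (rule C)
  interpret Q: group Q by (rule Q)
  let ?A = "sum_group (carrier Q) (\<lambda>_. C)"
  have car: "carrier ?A =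
      {a \<in> carrier Q \<rightarrow>\<^sub>E carrier C. finite {w \<in> carrier Q. a w \<noteq> \<one>\<^bsub>C\<^esub>}}"
    by (simp add: carrier_sum_group C)
  have cl: "shift_action C Q x a \<in> carrier ?A"
    if x: "x \<in> carrier Q" and a: "a \<in> carrier ?A" for x a
  proof -
    have "{w \<in> carrier Q. shift_action C Q x a w \<noteq> \<one>\<^bsub>C\<^esub>}
        \<subseteq> (\<lambda>w. x \<otimes>\<^bsub>Q\<^esub> w) ` {w \<in> carrier Q. a w \<noteq> \<one>\<^bsub>C\<^esub>}"
    proof
      fix w assume w: "w \<in> {w \<in> carrier Q. shift_action C Q x a w \<noteq> \<one>\<^bsub>C\<^esub>}"
      then have "w = x \<otimes>\<^bsub>Q\<^esub> (inv\<^bsub>Q\<^esub> x \<otimes>\<^bsub>Q\<^esub> w)" and "inv\<^bsub>Q\<^esub> x \<otimes>\<^bsub>Q\<^esub> w \<in> carrier Q"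
        using x by (simp_all add: Q.m_assoc[symmetric])
      then show "w \<in> (\<lambda>w. x \<otimes>\<^bsub>Q\<^esub> w) ` {w \<in> carrier Q. a w \<noteq> \<one>\<^bsub>C\<^esub>}"
        using w a by (auto simp: shift_action_def)
    qed
    moreover have "finite {w \<in> carrier Q. a w \<noteq> \<one>\<^bsub>C\<^esub>}"
      using a by (simp add: car)
    ultimately have "finite {w \<in> carrier Q. shift_action C Q x a w \<noteq> \<one>\<^bsub>C\<^esub>}"
      by (blast intro: finite_subset finite_imageI)
    moreover have "shift_action C Q x a \<in> carrier Q \<rightarrow>\<^sub>E carrier C"
    proof -
      have "a v \<in> carrier C" if "v \<in> carrier Q" for v
        using a that by (auto simp: car PiE_iff)
      then show ?thesis
        using a x by (simp add: shift_action_def restrict_PiE_iff)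
    qed
    ultimately show ?thesis by (simp add: car)
  qed
  have comp: "shift_action C Q (x \<otimes>\<^bsub>Q\<^esub> y) a = shift_action C Q x (shift_action C Q y a)"
    if "x \<in> carrier Q" "y \<in> carrier Q" "a \<in> carrier ?A" for x y a
    using that cl[OF that(2,3)]
    by (auto simp: shift_action_def Q.inv_mult_group Q.m_assoc intro!: restrict_ext)
  have one: "shift_action C Q \<one>\<^bsub>Q\<^esub> a = a" if "a \<in> carrier ?A" for a
    using that by (auto simp: shift_action_def car PiE_def extensional_def)
  have Bij: "shift_action C Q x \<in> Bij (carrier ?A)" if x: "x \<in> carrier Q" for x
  proof -
    have "bij_betw (shift_action C Q x) (carrier ?A) (carrier ?A)"
    proof (rule bij_betw_byWitness[where f' = "shift_action C Q (inv\<^bsub>Q\<^esub> x)"])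
      show "\<forall>a\<in>carrier ?A. shift_action C Q (inv\<^bsub>Q\<^esub> x) (shift_action C Q x a) = a"
        using x by (simp add: comp[symmetric] one)
      show "\<forall>a\<in>carrier ?A. shift_action C Q x (shift_action C Q (inv\<^bsub>Q\<^esub> x) a) = a"
        using x by (simp add: comp[symmetric] one)
    qed (use x cl in auto)
    then show ?thesis
      by (simp add: Bij_def shift_action_def)
  qed
  have hom: "shift_action C Q x \<in> hom ?A ?A" if x: "x \<in> carrier Q" for x
  proof (rule homI)
    fix a b assume ab: "a \<in> carrier ?A" "b \<in> carrier ?A"
    then have "a \<otimes>\<^bsub>?A\<^esub> b \<in> carrier ?A"
      by (intro monoid.m_closed group.is_monoid sum_group C)
    with ab show "shift_action C Q x (a \<otimes>\<^bsub>?A\<^esub> b)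
        = shift_action C Q x a \<otimes>\<^bsub>?A\<^esub> shift_action C Q x b"
      using x by (auto simp: shift_action_def intro!: restrict_ext)
  qed (rule cl[OF x])
  show ?thesis
  proof (rule homI)
    show "shift_action C Q x \<in> carrier (AutoGroup ?A)" if "x \<in> carrier Q" for x
      using hom[OF that] Bij[OF that] by (simp add: AutoGroup_def auto_def)
    show "shift_action C Q (x \<otimes>\<^bsub>Q\<^esub> y)
        = shift_action C Q x \<otimes>\<^bsub>AutoGroup ?A\<^esub> shift_action C Q y"
      if "x \<in> carrier Q" "y \<in> carrier Q" for x y
    proof (rule extensionalityI[where A = "carrier ?A"])
      show "shift_action C Q (x \<otimes>\<^bsub>Q\<^esub> y) \<in> extensional (carrier ?A)"
        by (simp add: shift_action_def)
      show "shift_action C Q x \<otimes>\<^bsub>AutoGroup ?A\<^esub> shift_action C Q y \<in> extensional (carrier ?A)"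
        using Bij that by (simp add: AutoGroup_def BijGroup_def)
    qed (use that Bij comp in \<open>simp add: AutoGroup_def BijGroup_def compose_eq\<close>)
  qed
qed

lemma group_restricted_wreath_product:
  assumes "group C" "group Q"
  shows "group (restricted_wreath_product C Q)"
  unfolding restricted_wreath_product_def
  by (intro group_semidirect_product sum_group assms shift_action_hom)


section \<open>Automorphisms of the rooted regular tree\<close>

definition tree_vertices :: "nat \<Rightarrow> nat list set"
  where "tree_vertices m = lists {0..<m}"

definition tree_adjacent :: "nat \<Rightarrow> nat list \<Rightarrow> nat list \<Rightarrow> bool"
  where "tree_adjacent m v w \<longleftrightarrow> (\<exists>i<m. w = v @ [i] \<or> v = w @ [i])"

definition tree_automorphisms :: "nat \<Rightarrow> (nat list \<Rightarrow> nat list) set"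
  where "tree_automorphisms m =
    {g \<in> Bij (tree_vertices m). g [] = [] \<and>
      (\<forall>v \<in> tree_vertices m. \<forall>w \<in> tree_vertices m.
        tree_adjacent m (g v) (g w) \<longleftrightarrow> tree_adjacent m v w)}"

text \<open>
  Automorphisms act on the right: in the product \<open>g \<otimes> h\<close> the factor \<open>g\<close> is applied first.
  This is the product of \<^const>\<open>BijGroup\<close> in the opposite order.
\<close>

definition tree_aut_group :: "nat \<Rightarrow> (nat list \<Rightarrow> nat list) monoid"
  where "tree_aut_group m =
    \<lparr>carrier = tree_automorphisms m,
     monoid.mult = (\<lambda>g h. compose (tree_vertices m) h g),
     one = (\<lambda>v \<in> tree_vertices m. v)\<rparr>"

text \<open>
  The automorphism \<open>g\<^sub>i\<close> with \<open>g (i # w) = \<sigma> i # g\<^sub>i w\<close>; see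
  \<open>tree_automorphism_Cons\<close> and \<open>tree_section_closed\<close> below.
\<close>

definition tree_section :: "nat \<Rightarrow> (nat list \<Rightarrow> nat list) \<Rightarrow> nat \<Rightarrow> (nat list \<Rightarrow> nat list)"
  where "tree_section m g i = (\<lambda>w \<in> tree_vertices m. tl (g (i # w)))"

inductive_set states :: "nat \<Rightarrow> (nat list \<Rightarrow> nat list) \<Rightarrow> (nat list \<Rightarrow> nat list) set"
  for m g where
  self: "g \<in> states m g"
| step: "h \<in> states m g \<Longrightarrow> i < m \<Longrightarrow> tree_section m h i \<in> states m g"

definition state_closed :: "nat \<Rightarrow> (nat list \<Rightarrow> nat list) set \<Rightarrow> bool"
  where "state_closed m H \<longleftrightarrow>
    subgroup H (tree_aut_group m) \<and> (\<forall>g \<in> H. states m g \<subseteq> H)"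

definition state_closed_representation ::
    "nat \<Rightarrow> ('a, 'b) monoid_scheme \<Rightarrow> ('a \<Rightarrow> nat list \<Rightarrow> nat list) \<Rightarrow> bool"
  where "state_closed_representation m G \<phi> \<longleftrightarrow>
    \<phi> \<in> hom G (tree_aut_group m) \<and> state_closed m (\<phi> ` carrier G)"

definition faithful_state_closed_representation ::
    "nat \<Rightarrow> ('a, 'b) monoid_scheme \<Rightarrow> ('a \<Rightarrow> nat list \<Rightarrow> nat list) \<Rightarrow> bool"
  where "faithful_state_closed_representation m G \<phi> \<longleftrightarrow>
    state_closed_representation m G \<phi> \<and> inj_on \<phi> (carrier G)"

lemma group_tree_aut_group: "group (tree_aut_group m)"
proof -
  let ?V = "tree_vertices m"
  have fs: "g \<in> ?V \<rightarrow> ?V" and ex: "g \<in> extensional ?V" if "g \<in> tree_automorphisms m" for g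
    using that by (auto simp: tree_automorphisms_def Bij_imp_funcset Bij_imp_extensional)
  have nil: "[] \<in> ?V" by (simp add: tree_vertices_def)
  show ?thesis
  proof (rule groupI)
    fix g assume "g \<in> carrier (tree_aut_group m)"
    then have g: "g \<in> tree_automorphisms m" by (simp add: tree_aut_group_def)
    then have B: "g \<in> Bij ?V" by (simp add: tree_automorphisms_def)
    let ?h = "\<lambda>v \<in> ?V. inv_into ?V g v"
    have bij: "bij_betw g ?V ?V" using B by (simp add: Bij_def)
    have gh: "g (?h v) = v" and hV: "?h v \<in> ?V" if "v \<in> ?V" for v
      using that bij by (auto simp: bij_betw_def f_inv_into_f inv_into_into)
    have hg: "?h (g v) = v" if "v \<in> ?V" for v
      using that bij by (auto simp: bij_betw_def)
    have "g [] = []" using g by (simp add: tree_automorphisms_def)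
    then have "?h [] = []" using hg[OF nil] by (simp only:)
    moreover have "tree_adjacent m (?h v) (?h w) \<longleftrightarrow> tree_adjacent m v w"
      if "v \<in> ?V" "w \<in> ?V" for v w
    proof -
      have "tree_adjacent m (g (?h v)) (g (?h w)) \<longleftrightarrow> tree_adjacent m (?h v) (?h w)"
        using g hV[OF that(1)] hV[OF that(2)] unfolding tree_automorphisms_def by blast
      then show ?thesis using gh that by simp
    qed
    ultimately have h: "?h \<in> tree_automorphisms m"
      using restrict_inv_into_Bij[OF B] by (simp add: tree_automorphisms_def)
    have "compose ?V g ?h = (\<lambda>v \<in> ?V. v)"
      using gh by (auto simp: compose_def)
    with h show "\<exists>h \<in> carrier (tree_aut_group m).
        h \<otimes>\<^bsub>tree_aut_group m\<^esub> g = \<one>\<^bsub>tree_aut_group m\<^esub>"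
      by (auto simp: tree_aut_group_def)
  next
    fix g h assume "g \<in> carrier (tree_aut_group m)" "h \<in> carrier (tree_aut_group m)"
    then have g: "g \<in> tree_automorphisms m" and h: "h \<in> tree_automorphisms m"
      by (simp_all add: tree_aut_group_def)
    then show "g \<otimes>\<^bsub>tree_aut_group m\<^esub> h \<in> carrier (tree_aut_group m)"
      using fs[OF g] nil
      by (auto simp: tree_aut_group_def tree_automorphisms_def compose_Bij compose_eq Pi_iff)
  next
    show "\<one>\<^bsub>tree_aut_group m\<^esub> \<in> carrier (tree_aut_group m)"
      using nil by (simp add: tree_aut_group_def tree_automorphisms_def id_Bij)
  next
    fix g h k
    assume "g \<in> carrier (tree_aut_group m)"
    then show "g \<otimes>\<^bsub>tree_aut_group m\<^esub> h \<otimes>\<^bsub>tree_aut_group m\<^esub> k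
        = g \<otimes>\<^bsub>tree_aut_group m\<^esub> (h \<otimes>\<^bsub>tree_aut_group m\<^esub> k)"
      using compose_assoc[OF fs, of g k h] by (simp add: tree_aut_group_def)
  next
    fix g assume "g \<in> carrier (tree_aut_group m)"
    then show "\<one>\<^bsub>tree_aut_group m\<^esub> \<otimes>\<^bsub>tree_aut_group m\<^esub> g = g"
      using compose_Id[OF fs ex, of g] by (simp add: tree_aut_group_def)
  qed
qed

lemma tree_vertices_Nil [simp]: "[] \<in> tree_vertices m"
  by (simp add: tree_vertices_def)

lemma tree_vertices_Cons [simp]: "i # w \<in> tree_vertices m \<longleftrightarrow> i < m \<and> w \<in> tree_vertices m"
  by (auto simp: tree_vertices_def)

lemma tree_vertices_append [simp]:
  "v @ w \<in> tree_vertices m \<longleftrightarrow> v \<in> tree_vertices m \<and> w \<in> tree_vertices m"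
  by (auto simp: tree_vertices_def)

lemma tree_automorphism_in_vertices:
  assumes "g \<in> tree_automorphisms m" "v \<in> tree_vertices m"
  shows "g v \<in> tree_vertices m"
  using assms by (auto simp: tree_automorphisms_def dest: Bij_imp_funcset)

lemma tree_automorphism_snoc:
  assumes g: "g \<in> tree_automorphisms m" and vi: "v @ [i] \<in> tree_vertices m"
  shows "\<exists>j<m. g (v @ [i]) = g v @ [j]"
  using vi
proof (induction v arbitrary: i rule: rev_induct)
  case Nil
  then have "[i] \<in> tree_vertices m" "tree_adjacent m [] [i]"
    by (simp_all add: tree_adjacent_def)
  then have "tree_adjacent m (g []) (g [i])"
    using g tree_vertices_Nil unfolding tree_automorphisms_def by blast
  moreover have "g [] = []" using g by (simp add: tree_automorphisms_def)
  ultimately show ?case by (auto simp: tree_adjacent_def)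
next
  case (snoc k v)
  let ?w = "v @ [k]"
  have V: "v \<in> tree_vertices m" "?w \<in> tree_vertices m" "i < m" "k < m"
    using snoc.prems by auto
  have "tree_adjacent m ?w (?w @ [i])"
    using V by (simp add: tree_adjacent_def)
  then have adj: "tree_adjacent m (g ?w) (g (?w @ [i]))"
    using g V(2) snoc.prems unfolding tree_automorphisms_def by blast
  have "g (?w @ [i]) \<noteq> g v"
  proof
    assume "g (?w @ [i]) = g v"
    moreover have "inj_on g (tree_vertices m)"
      using g by (simp add: tree_automorphisms_def Bij_def bij_betw_def)
    ultimately have "?w @ [i] = v"
      using V by (auto dest!: inj_onD)
    then show False by simp
  qed
  then show ?case
    using adj snoc.IH[OF V(2)] by (auto simp: tree_adjacent_def)
qed

lemma tree_automorphism_append: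
  assumes g: "g \<in> tree_automorphisms m" and vw: "v @ w \<in> tree_vertices m"
  shows "\<exists>u \<in> tree_vertices m. length u = length w \<and> g (v @ w) = g v @ u"
  using vw
proof (induction w rule: rev_induct)
  case Nil
  show ?case by (intro bexI[of _ "[]"]) simp_all
next
  case (snoc i w)
  then obtain u where "u \<in> tree_vertices m" "length u = length w" "g (v @ w) = g v @ u"
    by auto
  moreover obtain j where "j < m" "g ((v @ w) @ [i]) = g (v @ w) @ [j]"
    using tree_automorphism_snoc[OF g, of "v @ w" i] snoc.prems by auto
  ultimately show ?case by (intro bexI[of _ "u @ [j]"]) simp_all
qed

lemma tree_automorphism_Cons:
  assumes g: "g \<in> tree_automorphisms m" and i: "i < m" and w: "w \<in> tree_vertices m"
  shows "g (i # w) = hd (g [i]) # tree_section m g i w" and "g [i] = [hd (g [i])]"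
proof -
  obtain j where j: "g [i] = [j]"
    using tree_automorphism_snoc[OF g, of "[]" i] i g by (auto simp: tree_automorphisms_def)
  then show "g [i] = [hd (g [i])]" by simp
  obtain u where "g ([i] @ w) = g [i] @ u"
    using tree_automorphism_append[OF g, of "[i]" w] i w by auto
  then show "g (i # w) = hd (g [i]) # tree_section m g i w"
    using j w by (simp add: tree_section_def)
qed

lemma tree_level_one_permutation:
  assumes g: "g \<in> tree_automorphisms m"
  shows "bij_betw (\<lambda>i. hd (g [i])) {0..<m} {0..<m}"
proof -
  have inj: "inj_on (\<lambda>i. hd (g [i])) {0..<m}"
  proof (rule inj_onI)
    fix i j assume ij: "i \<in> {0..<m}" "j \<in> {0..<m}" "hd (g [i]) = hd (g [j])"
    then have "g [i] = g [j]"
      using tree_automorphism_Cons(2)[OF g, of _ "[]"] by (metis atLeastLessThan_iff tree_vertices_Nil)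
    moreover have "inj_on g (tree_vertices m)"
      using g by (simp add: tree_automorphisms_def Bij_def bij_betw_def)
    ultimately show "i = j" using ij by (auto dest!: inj_onD)
  qed
  moreover have "(\<lambda>i. hd (g [i])) ` {0..<m} \<subseteq> {0..<m}"
  proof
    fix j assume "j \<in> (\<lambda>i. hd (g [i])) ` {0..<m}"
    then obtain i where "i < m" "j = hd (g [i])" by auto
    moreover have "g [i] \<in> tree_vertices m" using \<open>i < m\<close>
      by (intro tree_automorphism_in_vertices[OF g]) simp
    ultimately show "j \<in> {0..<m}"
      using tree_automorphism_Cons(2)[OF g, of i "[]"]
      by (metis atLeastLessThan_iff le0 tree_vertices_Cons tree_vertices_Nil)
  qed
  ultimately show ?thesis
    by (simp add: bij_betw_def endo_inj_surj)
qed

lemma tree_section_closed: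
  assumes g: "g \<in> tree_automorphisms m" and i: "i < m"
  shows "tree_section m g i \<in> tree_automorphisms m"
proof -
  let ?V = "tree_vertices m" and ?s = "tree_section m g i"
  define j where "j = hd (g [i])"
  have Cons: "g (i # w) = j # ?s w" if "w \<in> ?V" for w
    unfolding j_def by (rule tree_automorphism_Cons[OF g i that])
  have inV: "?s w \<in> ?V" if "w \<in> ?V" for w
    using tree_automorphism_in_vertices[OF g, of "i # w"] Cons[OF that] that i by simp
  have bij: "bij_betw g ?V ?V" using g by (simp add: tree_automorphisms_def Bij_def)
  have nil: "?s [] = []"
    using tree_automorphism_Cons(2)[OF g i tree_vertices_Nil]
    by (metis list.sel(3) restrict_apply tree_section_def tree_vertices_Nil)
  have "inj_on ?s ?V"
  proof (rule inj_onI)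
    fix v w assume vw: "v \<in> ?V" "w \<in> ?V" "?s v = ?s w"
    then have "g (i # v) = g (i # w)" by (simp add: Cons)
    then show "v = w"
      using bij vw i by (auto simp: bij_betw_def dest!: inj_onD)
  qed
  moreover have "?V \<subseteq> ?s ` ?V"
  proof
    fix u assume u: "u \<in> ?V"
    have "g [i] \<in> ?V" using i by (intro tree_automorphism_in_vertices[OF g]) simp
    then have j: "j < m"
      unfolding j_def using tree_automorphism_Cons(2)[OF g i tree_vertices_Nil]
      by (metis tree_vertices_Cons)
    then obtain v where v: "v \<in> ?V" "g v = j # u"
      using bij u by (metis bij_betw_def imageE tree_vertices_Cons)
    moreover have "v \<noteq> []" using v g by (auto simp: tree_automorphisms_def)
    ultimately obtain k w where kw: "v = k # w" "k < m" "w \<in> ?V"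
      by (cases v) auto
    then have "hd (g [k]) = j" "u = tree_section m g k w"
      using v tree_automorphism_Cons(1)[OF g kw(2,3)] by (metis list.inject)+
    moreover from this have "k = i"
      using tree_level_one_permutation[OF g] kw(2) i
      unfolding j_def bij_betw_def inj_on_def by simp
    ultimately show "u \<in> ?s ` ?V" using kw by auto
  qed
  ultimately have "?s \<in> Bij ?V"
    using inV by (auto simp: Bij_def bij_betw_def tree_section_def)
  moreover have "tree_adjacent m (?s v) (?s w) \<longleftrightarrow> tree_adjacent m v w"
    if vw: "v \<in> ?V" "w \<in> ?V" for v w
  proof -
    have *: "tree_adjacent m (k # x) (k # y) \<longleftrightarrow> tree_adjacent m x y" for k x y
      by (auto simp: tree_adjacent_def)
    have "i # v \<in> ?V" "i # w \<in> ?V" using vw i by simp_all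
    then have "tree_adjacent m (g (i # v)) (g (i # w)) \<longleftrightarrow> tree_adjacent m (i # v) (i # w)"
      using g unfolding tree_automorphisms_def by blast
    then show ?thesis by (simp add: Cons vw *)
  qed
  ultimately show ?thesis
    by (simp add: tree_automorphisms_def nil)
qed

end

theory Submission
  imports Defs "HOL-Algebra.Multiplicative_Group"
begin

text \<open>
  Let \<open>A\<close> be the base group, a module over the group ring of \<open>X\<close>, let \<open>H\<close> be the stabilizer of the
  vertex \<open>0\<close>, and let \<open>f : H \<rightarrow> G\<close> map an element to its section at \<open>0\<close>. If the action on the first
  level is transitive, a set that is closed under conjugation, lies in \<open>H\<close> and is mapped into itself
  by \<open>f\<close> acts trivially on the tree.

  Sections preserve torsion, so \<open>A\<close> acts nontrivially on the first level; as \<open>p\<close> is prime, \<open>A\<close> is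
  transitive there. Hence \<open>G = H A\<close>, and \<open>f\<close> induces an endomorphism \<open>\<lambda>\<close> of \<open>X\<close>. It is injective,
  because \<open>\<lambda> x = 1\<close> implies that \<open>f\<close> kills \<open>(x - 1) (A \<inter> H)\<close>.

  Let \<open>m = p!\<close>. An \<open>m\<close>-th power acts trivially on the first level, so \<open>(x\<^sup>m - 1) A\<close> lies in \<open>H\<close>. As
  the rank is at least two, for \<open>u = x\<^sup>m \<noteq> 1\<close> there is an independent \<open>v = y\<^sup>m\<close>, and applying \<open>f\<close> to
  \<open>(v - 1) (u - 1) a = (u - 1) (v - 1) a\<close> gives
  \<open>(\<lambda> v - 1) f ((u - 1) a) = (\<lambda> u - 1) f ((v - 1) a)\<close>. Since \<open>\<lambda> u\<close> and \<open>\<lambda> v\<close> are independent,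
  \<open>f ((u - 1) a)\<close> lies in \<open>(\<lambda> u - 1) A\<close>. So the union of the sets \<open>(x\<^sup>m - 1) A\<close> is mapped into
  itself by \<open>f\<close>, although it is not trivial.
\<close>

section \<open>Self-similar actions\<close>

text \<open>Models a faithful state-closed representation: \<open>act\<close> is the action on the
  first level and \<open>sect\<close> gives the states, pulled back to the group. Actions are on the
  right, hence the order in \<open>act_mult\<close>. Injectivity becomes \<open>faithful\<close>: a
  set whose elements fix the first level and have all their sections in the set fixes every
  vertex.\<close>

locale self_similar_action = group G for G (structure) +
  fixes m :: nat and act :: "'a \<Rightarrow> nat \<Rightarrow> nat" and sect :: "'a \<Rightarrow> nat \<Rightarrow> 'a"
  assumes act_less: "\<lbrakk>g \<in> carrier G; i < m\<rbrakk> \<Longrightarrow> act g i < m"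
    and act_one: "i < m \<Longrightarrow> act \<one> i = i"
    and act_mult: "\<lbrakk>g \<in> carrier G; h \<in> carrier G; i < m\<rbrakk> \<Longrightarrow> act (g \<otimes> h) i = act h (act g i)"
    and sect_closed: "\<lbrakk>g \<in> carrier G; i < m\<rbrakk> \<Longrightarrow> sect g i \<in> carrier G"
    and sect_mult: "\<lbrakk>g \<in> carrier G; h \<in> carrier G; i < m\<rbrakk>
      \<Longrightarrow> sect (g \<otimes> h) i = sect g i \<otimes> sect h (act g i)"
    and faithful: "\<lbrakk>K \<subseteq> carrier G; \<And>k i. \<lbrakk>k \<in> K; i < m\<rbrakk> \<Longrightarrow> act k i = i \<and> sect k i \<in> K\<rbrakk>
      \<Longrightarrow> K \<subseteq> {\<one>}"
begin

section \<open>Powers, inverses and their sections\<close>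

lemma sect_one:
  assumes "i < m"
  shows "sect \<one> i = \<one>"
proof -
  have "sect \<one> i \<otimes> sect \<one> i = sect \<one> i"
    using sect_mult[of \<one> \<one> i] assms by (simp add: act_one)
  then show ?thesis
    using assms sect_closed[of \<one> i] by simp
qed

lemma act_inv:
  assumes "g \<in> carrier G" "i < m"
  shows "act (inv g) (act g i) = i" "act g (act (inv g) i) = i"
  using act_mult[of g "inv g" i] act_mult[of "inv g" g i] assms by (simp_all add: act_one)

lemma act_inject:
  assumes "g \<in> carrier G" "i < m" "j < m" "act g i = act g j"
  shows "i = j"
  using act_inv(1) assms by metis

lemma act_pow_add:
  assumes "g \<in> carrier G" "i < m"
  shows "act (g [^] (k + l :: nat)) i = act (g [^] l) (act (g [^] k) i)"
  using assms by (simp add: act_mult flip: nat_pow_mult)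

lemma act_pow_mult_fixed:
  assumes "g \<in> carrier G" "i < m" "act (g [^] (k :: nat)) i = i"
  shows "act (g [^] (k * l)) i = i"
  by (induction l) (use assms in \<open>simp_all add: act_one act_pow_add\<close>)

lemma act_pow_fixed:
  assumes "g \<in> carrier G" "i < m" "act g i = i"
  shows "act (g [^] (k :: nat)) i = i"
  using act_pow_mult_fixed[of g i 1 k] assms by simp

lemma sect_pow:
  assumes "g \<in> carrier G" "i < m" "act g i = i"
  shows "sect (g [^] (k :: nat)) i = sect g i [^] k"
  by (induction k) (use assms in \<open>simp_all add: sect_one sect_mult act_pow_fixed\<close>)

lemma act_inv_fixed:
  assumes "g \<in> carrier G" "i < m" "act g i = i"
  shows "act (inv g) i = i"
  using act_inv(1)[OF assms(1,2)] assms(3) by simp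

lemma sect_inv:
  assumes "g \<in> carrier G" "i < m" "act g i = i"
  shows "sect (inv g) i = inv (sect g i)"
  using sect_mult[of "inv g" g i] assms act_inv_fixed[OF assms]
  by (simp add: sect_one sect_closed inv_equality)

lemma sect_inv':
  assumes "g \<in> carrier G" "i < m"
  shows "sect (inv g) (act g i) = inv (sect g i)"
proof -
  have "\<one> = sect g i \<otimes> sect (inv g) (act g i)"
    using sect_mult[of g "inv g" i] assms by (simp add: sect_one)
  then show ?thesis
    using assms by (metis act_less inv_closed inv_comm inv_equality sect_closed)
qed

section \<open>Orbits on the first level\<close>

lemma act_pow_eq_imp_fixed:
  assumes "g \<in> carrier G" "i < m" "k \<le> l" "act (g [^] k) i = act (g [^] (l :: nat)) i"
  shows "act (g [^] (l - k)) i = i"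
proof -
  have "act (g [^] k) (act (g [^] (l - k)) i) = act (g [^] k) i"
    using act_pow_add[of g i "l - k" k] assms by simp
  then show ?thesis
    using assms by (meson act_inject act_less nat_pow_closed)
qed

text \<open>By pigeonhole two exponents in \<open>{0..m}\<close> send \<open>i\<close> to the same
  point, so \<open>i\<close> returns after \<open>l - k\<close> steps; this number is positive and
  at most \<open>m\<close>, hence divides \<open>fact m\<close>.\<close>

lemma act_fact_pow:
  assumes "g \<in> carrier G" "i < m"
  shows "act (g [^] (fact m :: nat)) i = i"
proof -
  have "(\<lambda>k. act (g [^] k) i) ` {0..m} \<subseteq> {..<m}"
    using assms act_less by auto
  then have "card ((\<lambda>k. act (g [^] k) i) ` {0..m}) \<le> m"
    using card_mono[of "{..<m}"] by fastforce
  then have "\<not> inj_on (\<lambda>k. act (g [^] k) i) {0..m}"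
    by (auto dest: card_image)
  then obtain k l where kl: "k < l" "l \<le> m" "act (g [^] k) i = act (g [^] l) i"
    unfolding inj_on_def by (metis atLeastAtMost_iff linorder_neqE_nat)
  then have "act (g [^] (l - k)) i = i"
    using assms by (intro act_pow_eq_imp_fixed) auto
  moreover have "l - k dvd fact m"
    using kl by (intro dvd_fact) auto
  ultimately show ?thesis
    using act_pow_mult_fixed[OF assms] by (metis dvdE)
qed

text \<open>The element permutes the \<open>m\<close> points in a single cycle.\<close>

lemma prime_order_transitive:
  assumes "prime m" "g \<in> carrier G" "g [^] m = \<one>" "i < m" "act g i \<noteq> i" "j < m"
  shows "\<exists>k::nat. act (g [^] k) i = j"
proof -
  have "inj_on (\<lambda>k. act (g [^] k) i) {..<m}"
  proof (rule ccontr)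
    assume "\<not> inj_on (\<lambda>k. act (g [^] k) i) {..<m}"
    then obtain k l where kl: "k < l" "l < m" "act (g [^] k) i = act (g [^] l) i"
      unfolding inj_on_def by (metis lessThan_iff linorder_neqE_nat)
    define n where "n = l - k"
    have n: "act (g [^] n) i = i" "0 < n" "n < m"
      using act_pow_eq_imp_fixed[of g i k l] assms kl by (auto simp: n_def)
    then have "coprime n m"
      using assms(1) prime_imp_coprime[of m n] nat_dvd_not_less[of n m] by (auto simp: coprime_commute)
    \<comment> \<open>As \<open>g [^] m = \<one>\<close>, Bezout turns \<open>g [^] (n * a)\<close>
      into \<open>g\<close>; a return after \<open>n\<close> steps would thus make \<open>g\<close>
      fix \<open>i\<close>.\<close>
    then obtain a b where ab: "n * a = m * b + 1"
      using bezout_nat[of n m] \<open>0 < n\<close> by (metis coprime_imp_gcd_eq_1 neq0_conv)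
    have "g [^] (n * a) = (g [^] m) [^] b \<otimes> g [^] (1::nat)"
      unfolding ab using assms(2) by (simp only: nat_pow_pow nat_pow_mult nat_pow_closed)
    then have "g [^] (n * a) = g"
      using assms(2,3) by simp
    with act_pow_mult_fixed[OF assms(2,4) n(1), of a] show False
      using assms(5) by simp
  qed
  moreover have "(\<lambda>k. act (g [^] k) i) ` {..<m} \<subseteq> {..<m}"
    using assms act_less by auto
  ultimately have "(\<lambda>k. act (g [^] k) i) ` {..<m} = {..<m}"
    by (simp add: endo_inj_surj)
  then have "j \<in> (\<lambda>k. act (g [^] k) i) ` {..<m}"
    using assms(6) by simp
  then show ?thesis
    by blast
qed

text \<open>
  A transitive action is determined by its virtual endomorphism, the section at one point:
  the sections elsewhere are conjugate to it.
\<close>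

lemma transitive_faithful:
  assumes "i < m" and trans: "\<And>j. j < m \<Longrightarrow> \<exists>g \<in> carrier G. act g i = j"
    and K: "K \<subseteq> carrier G"
    and conj: "\<And>k g. \<lbrakk>k \<in> K; g \<in> carrier G\<rbrakk> \<Longrightarrow> g \<otimes> k \<otimes> inv g \<in> K"
    and fix_K: "\<And>k. k \<in> K \<Longrightarrow> act k i = i"
    and sect_K: "\<And>k. k \<in> K \<Longrightarrow> sect k i \<in> K"
  shows "K \<subseteq> {\<one>}"
proof (rule faithful[OF K])
  fix k j assume k: "k \<in> K" and "j < m"
  then obtain g where g: "g \<in> carrier G" and j: "act g i = j"
    using trans by blast
  \<comment> \<open>The conjugate \<open>k'\<close> again lies in \<open>K\<close>, so its section
    at \<open>i\<close> does too; the section of \<open>k\<close> at \<open>j\<close> is conjugate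
    to that one.\<close>
  define k' where "k' = g \<otimes> k \<otimes> inv g"
  have k': "k' \<in> K" "k' \<in> carrier G" "k \<in> carrier G"
    using k g K conj by (auto simp: k'_def)
  have k_eq: "k = inv g \<otimes> k' \<otimes> g"
    using k' g by (simp add: k'_def m_assoc inv_solve_left)
  have "act (inv g) j = i"
    using g \<open>i < m\<close> j act_inv(1) by blast
  then have "act k j = j"
    using k' g j \<open>j < m\<close> fix_K by (simp add: k_eq act_mult)
  moreover have "sect k j = inv (sect g i) \<otimes> sect k' i \<otimes> sect g i"
    using k' g j \<open>j < m\<close> \<open>act (inv g) j = i\<close> fix_K sect_inv'[OF g \<open>i < m\<close>]
    by (simp add: k_eq sect_mult act_mult)
  moreover have "inv (sect g i) \<otimes> sect k' i \<otimes> sect g i \<in> K"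
    using conj[OF sect_K[OF k'(1)], of "inv (sect g i)"] g \<open>i < m\<close> sect_closed by simp
  ultimately show "act k j = j \<and> sect k j \<in> K"
    by simp
qed

end

section \<open>Self-similar extensions of abelian groups\<close>

text \<open>In an abelian group: \<open>x\<close> and \<open>y\<close> freely generate a free
  abelian group of rank two. Setting one exponent to zero shows that both have infinite
  order.\<close>

definition mult_independent :: "('c, 'd) monoid_scheme \<Rightarrow> 'c \<Rightarrow> 'c \<Rightarrow> bool"
  where "mult_independent Q x y \<longleftrightarrow> (\<forall>(i::int) (j::int). x [^]\<^bsub>Q\<^esub> i = y [^]\<^bsub>Q\<^esub> j \<longrightarrow> i = 0 \<and> j = 0)"

lemma (in group) inv_cancel_left [simp]:
  assumes "x \<in> carrier G" "y \<in> carrier G"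
  shows "inv x \<otimes> (x \<otimes> y) = y" "x \<otimes> (inv x \<otimes> y) = y"
  using assms by (simp_all flip: m_assoc)

section \<open>The abelian kernel as a module over the quotient\<close>

locale abelian_by_abelian = G?: group G + Q: comm_group Q + group_hom G Q \<pi>
  for G (structure) and Q and \<pi> +
  assumes kernel_comm: "\<lbrakk>a \<in> kernel G Q \<pi>; b \<in> kernel G Q \<pi>\<rbrakk> \<Longrightarrow> a \<otimes> b = b \<otimes> a"
begin

abbreviation "A \<equiv> kernel G Q \<pi>"

definition comm :: "'a \<Rightarrow> 'a \<Rightarrow> 'a"
  where "comm g a = g \<otimes> a \<otimes> inv g \<otimes> inv a"

lemma comm_closed [simp]:
  "\<lbrakk>g \<in> carrier G; a \<in> carrier G\<rbrakk> \<Longrightarrow> comm g a \<in> carrier G"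
  by (simp add: comm_def)

lemma comm_one [simp]: "g \<in> carrier G \<Longrightarrow> comm g \<one> = \<one>"
  by (simp add: comm_def)

lemma comm_eq_one_iff:
  assumes "g \<in> carrier G" "a \<in> carrier G"
  shows "comm g a = \<one> \<longleftrightarrow> g \<otimes> a = a \<otimes> g"
proof -
  have "comm g a = (g \<otimes> a) \<otimes> inv (a \<otimes> g)"
    using assms by (simp add: comm_def G.inv_mult_group G.m_assoc)
  then show ?thesis
    using assms by (metis G.inv_closed G.inv_equality G.inv_inv G.m_closed G.r_inv)
qed

lemma conj_comm:
  assumes "x \<in> carrier G" "g \<in> carrier G" "a \<in> carrier G"
  shows "x \<otimes> comm g a \<otimes> inv x = comm (x \<otimes> g \<otimes> inv x) (x \<otimes> a \<otimes> inv x)"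
  using assms by (simp add: comm_def G.inv_mult_group G.m_assoc)

lemma kernelD:
  assumes "a \<in> A"
  shows "a \<in> carrier G" "\<pi> a = \<one>\<^bsub>Q\<^esub>"
  using assms by (simp_all add: kernel_def)

lemma kernel_iff: "g \<in> carrier G \<Longrightarrow> g \<in> A \<longleftrightarrow> \<pi> g = \<one>\<^bsub>Q\<^esub>"
  by (simp add: kernel_def)

lemma kernel_mult [simp]: "\<lbrakk>a \<in> A; b \<in> A\<rbrakk> \<Longrightarrow> a \<otimes> b \<in> A"
  by (simp add: kernel_def)

lemma kernel_inv [simp]: "a \<in> A \<Longrightarrow> inv a \<in> A"
  by (simp add: kernel_def)

lemma kernel_conj [simp]: "\<lbrakk>g \<in> carrier G; a \<in> A\<rbrakk> \<Longrightarrow> g \<otimes> a \<otimes> inv g \<in> A"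
  by (simp add: kernel_def)

lemma image_conj:
  assumes "x \<in> carrier G" "g \<in> carrier G"
  shows "\<pi> (x \<otimes> g \<otimes> inv x) = \<pi> g"
  using assms Q.m_comm[of "\<pi> x" "\<pi> g"] by (simp add: Q.m_assoc)

lemma comm_kernel [simp]: "\<lbrakk>g \<in> carrier G; a \<in> A\<rbrakk> \<Longrightarrow> comm g a \<in> A"
  by (simp add: comm_def)

text \<open>\<open>g\<close> and \<open>h\<close> differ by a kernel element, which commutes with
  the conjugates of \<open>a\<close>. Thus conjugation on the kernel factors through
  \<open>\<pi>\<close>.\<close>

lemma conj_eq_of_image_eq:
  assumes "g \<in> carrier G" "h \<in> carrier G" "a \<in> A" "\<pi> g = \<pi> h"
  shows "g \<otimes> a \<otimes> inv g = h \<otimes> a \<otimes> inv h"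
proof -
  define c where "c = g \<otimes> inv h"
  have c: "c \<in> A" "c \<in> carrier G"
    using assms by (simp_all add: c_def kernel_def)
  have "g = c \<otimes> h"
    using assms by (simp add: c_def G.m_assoc)
  then have "g \<otimes> a \<otimes> inv g = c \<otimes> (h \<otimes> a \<otimes> inv h) \<otimes> inv c"
    using assms c kernelD by (simp add: G.m_assoc G.inv_mult_group)
  also have "\<dots> = h \<otimes> a \<otimes> inv h"
  proof -
    have "c \<otimes> (h \<otimes> a \<otimes> inv h) = (h \<otimes> a \<otimes> inv h) \<otimes> c"
      using assms c by (intro kernel_comm) simp_all
    then show ?thesis
      using assms c kernelD(1) by (simp only: G.m_assoc G.r_inv G.r_one G.m_closed G.inv_closed)
  qed
  finally show ?thesis .
qed

lemma comm_eq_of_image_eq: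
  assumes "g \<in> carrier G" "h \<in> carrier G" "a \<in> A" "\<pi> g = \<pi> h"
  shows "comm g a = comm h a"
  using conj_eq_of_image_eq[OF assms] by (simp add: comm_def)

lemma comm_kernel_kernel: "\<lbrakk>a \<in> A; b \<in> A\<rbrakk> \<Longrightarrow> comm a b = \<one>"
  by (simp add: comm_eq_one_iff kernelD kernel_comm)

text \<open>As \<open>Q\<close> is commutative, conjugating \<open>g\<close> by \<open>x\<close>
  does not change its image, and only the image matters for \<open>comm\<close> on the
  kernel.\<close>

lemma conj_comm_kernel:
  assumes "x \<in> carrier G" "g \<in> carrier G" "a \<in> A"
  shows "x \<otimes> comm g a \<otimes> inv x = comm g (x \<otimes> a \<otimes> inv x)"
proof -
  have "x \<otimes> comm g a \<otimes> inv x = comm (x \<otimes> g \<otimes> inv x) (x \<otimes> a \<otimes> inv x)"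
    using assms by (intro conj_comm) (simp_all add: kernelD)
  also have "\<dots> = comm g (x \<otimes> a \<otimes> inv x)"
    using assms by (intro comm_eq_of_image_eq image_conj) simp_all
  finally show ?thesis .
qed

text \<open>
  The kernel is a module over the commutative group ring of the quotient, on which \<open>comm g\<close> is
  multiplication by \<open>\<pi> g - 1\<close>.
\<close>

lemma comm_left_commute:
  assumes g: "g \<in> carrier G" and h: "h \<in> carrier G" and a: "a \<in> A"
  shows "comm g (comm h a) = comm h (comm g a)"
proof -
  \<comment> \<open>Additively this is \<open>g h a - g a + a - h a\<close>. Exchanging
    \<open>g\<close> and \<open>h\<close> changes only the order of the product \<open>g h\<close>
    and of the summands.\<close>
  have *: "comm g (comm h a) =
      (g \<otimes> h) \<otimes> a \<otimes> inv (g \<otimes> h) \<otimes> (inv (g \<otimes> a \<otimes> inv g) \<otimes> (a \<otimes> inv (h \<otimes> a \<otimes> inv h)))"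
    if "g \<in> carrier G" "h \<in> carrier G" for g h
    using that a kernelD(1)[OF a] by (simp add: comm_def G.m_assoc G.inv_mult_group)
  have "(g \<otimes> h) \<otimes> a \<otimes> inv (g \<otimes> h) = (h \<otimes> g) \<otimes> a \<otimes> inv (h \<otimes> g)"
    using g h a by (intro conj_eq_of_image_eq) (simp_all add: Q.m_comm)
  moreover have "inv (g \<otimes> a \<otimes> inv g) \<otimes> (a \<otimes> inv (h \<otimes> a \<otimes> inv h)) =
      inv (h \<otimes> a \<otimes> inv h) \<otimes> (a \<otimes> inv (g \<otimes> a \<otimes> inv g))"
  proof -
    let ?x = "inv (g \<otimes> a \<otimes> inv g)" and ?y = "inv (h \<otimes> a \<otimes> inv h)"
    have xy: "?x \<in> A" "?y \<in> A"
      using g h a by simp_all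
    have "?x \<otimes> (a \<otimes> ?y) = (a \<otimes> ?y) \<otimes> ?x"
      using xy a by (intro kernel_comm) simp_all
    also have "\<dots> = (?y \<otimes> a) \<otimes> ?x"
      using kernel_comm[OF a xy(2)] by (rule arg_cong)
    also have "\<dots> = ?y \<otimes> (a \<otimes> ?x)"
      using xy a kernelD(1) by (intro G.m_assoc) blast+
    finally show ?thesis .
  qed
  ultimately show ?thesis
    using *[OF g h] *[OF h g] by simp
qed

end

text \<open>Collects the features of the wreath product that lead to the contradiction. In module
  terms, \<open>centralizer\<close> says that \<open>x - 1\<close> is injective on \<open>A\<close>
  for \<open>x \<noteq> 1\<close>, and \<open>comm_divisible\<close> that \<open>x - 1\<close> is
  injective on \<open>A / (y - 1) A\<close> for independent \<open>x\<close> and \<open>y\<close>.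
  Rank at least two enters through \<open>exists_independent\<close>.\<close>

locale self_similar_extension =
  abelian_by_abelian G Q \<pi> + self_similar_action G p act sect
  for G (structure) and Q and \<pi> and p act sect +
  assumes prime: "prime p"
    and kernel_pow: "a \<in> kernel G Q \<pi> \<Longrightarrow> a [^] p = \<one>"
    and kernel_nontrivial: "\<not> kernel G Q \<pi> \<subseteq> {\<one>}"
    and quotient_nontrivial: "\<not> carrier G \<subseteq> kernel G Q \<pi>"
    and exists_independent:
      "g \<in> carrier G \<Longrightarrow> g \<notin> kernel G Q \<pi> \<Longrightarrow> \<exists>h \<in> carrier G. mult_independent Q (\<pi> g) (\<pi> h)"
    and centralizer:
      "\<lbrakk>g \<in> carrier G; g \<notin> kernel G Q \<pi>; a \<in> kernel G Q \<pi>; comm g a = \<one>\<rbrakk> \<Longrightarrow> a = \<one>"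
    and comm_divisible:
      "\<lbrakk>g \<in> carrier G; h \<in> carrier G; mult_independent Q (\<pi> g) (\<pi> h); a \<in> kernel G Q \<pi>;
        b \<in> kernel G Q \<pi>; comm g a = comm h b\<rbrakk> \<Longrightarrow> \<exists>c \<in> kernel G Q \<pi>. a = comm h c"
begin

section \<open>Torsion, and transitivity of the kernel on the first level\<close>

lemma zero_less: "0 < p"
  using prime by (simp add: prime_gt_0_nat)

text \<open>Outside the kernel the image of \<open>g\<close> has an independent partner, hence
  infinite order.\<close>

lemma torsion:
  assumes "g \<in> carrier G" "g [^] (n::nat) \<in> A" "0 < n"
  shows "g \<in> A"
proof (rule ccontr)
  assume "g \<notin> A"
  then obtain h where "h \<in> carrier G" "mult_independent Q (\<pi> g) (\<pi> h)"
    using assms exists_independent by blast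
  moreover have "\<pi> g [^]\<^bsub>Q\<^esub> int n = \<pi> h [^]\<^bsub>Q\<^esub> (0::int)"
    using assms kernelD(2)[OF assms(2)] by (simp add: hom_nat_pow int_pow_int)
  ultimately show False
    using assms(3) unfolding mult_independent_def by fastforce
qed

text \<open>Taking the section at a fixed point respects powers, so the \<open>p\<close>-th power of
  the section is trivial and \<open>torsion\<close> applies.\<close>

lemma sect_kernel:
  assumes "a \<in> A" "i < p" "act a i = i"
  shows "sect a i \<in> A"
proof (rule torsion)
  have "sect a i [^] p = \<one>"
    using sect_pow[of a i p] kernel_pow[of a] kernelD[of a] assms sect_one by simp
  then show "sect a i [^] p \<in> A"
    by (simp add: kernel_def)
qed (use assms zero_less kernelD sect_closed in auto)

lemma kernel_transitive:
  assumes "i < p" "j < p"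
  shows "\<exists>a \<in> A. act a i = j"
proof -
  obtain a k where a: "a \<in> A" "k < p" "act a k \<noteq> k"
  proof (rule ccontr)
    assume "\<not> thesis"
    then have "\<forall>a \<in> A. \<forall>k < p. act a k = k"
      using that by blast
    \<comment> \<open>By \<open>sect_kernel\<close>, a kernel that fixes the first level is closed
      under sections.\<close>
    then have "A \<subseteq> {\<one>}"
      using sect_kernel by (intro faithful) (auto simp: kernelD)
    then show False
      using kernel_nontrivial by simp
  qed
  have a_pow: "a [^] (n::nat) \<in> A" for n
    using a by (simp add: kernel_def hom_nat_pow)
  \<comment> \<open>From the moved point \<open>k\<close> the cycle of \<open>a\<close> reaches both
    \<open>i\<close> and \<open>j\<close>; going back from \<open>i\<close> to \<open>k\<close>
    connects them.\<close>
  obtain r s :: nat where r: "act (a [^] r) k = i" and s: "act (a [^] s) k = j"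
    using prime_order_transitive[OF prime kernelD(1)[OF a(1)] kernel_pow[OF a(1)] a(2,3)] assms by blast
  have "act (inv (a [^] r) \<otimes> a [^] s) i = j"
    using a r s kernelD[OF a(1)] assms act_inv(1)[of "a [^] r" k] by (simp add: act_mult)
  then show ?thesis
    using kernel_mult[OF kernel_inv[OF a_pow] a_pow] by blast
qed

text \<open>Frattini argument: as the kernel is transitive, a kernel factor on the left of
  \<open>g\<close> can first move \<open>0\<close> to the point that \<open>g\<close> sends to
  \<open>0\<close>.\<close>

lemma exists_stabilizing:
  assumes "g \<in> carrier G"
  shows "\<exists>h \<in> carrier G. \<pi> h = \<pi> g \<and> act h 0 = 0"
proof -
  obtain a where a: "a \<in> A" "act a 0 = act (inv g) 0"
    using kernel_transitive[of 0 "act (inv g) 0"] assms act_less zero_less by auto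
  then have "act (a \<otimes> g) 0 = 0"
    using assms zero_less act_inv(2)[of g 0] kernelD(1)[OF a(1)] by (simp add: act_mult)
  then show ?thesis
    using assms a kernelD[OF a(1)] by (intro bexI[of _ "a \<otimes> g"]) auto
qed

text \<open>The form of \<open>transitive_faithful\<close> used for both contradictions below, with
  transitivity supplied by the kernel.\<close>

lemma core_trivial:
  assumes K: "K \<subseteq> carrier G"
    and conj: "\<And>k g. \<lbrakk>k \<in> K; g \<in> carrier G\<rbrakk> \<Longrightarrow> g \<otimes> k \<otimes> inv g \<in> K"
    and "\<And>k. k \<in> K \<Longrightarrow> act k 0 = 0"
    and "\<And>k. k \<in> K \<Longrightarrow> sect k 0 \<in> K"
  shows "K \<subseteq> {\<one>}"
proof (rule transitive_faithful[OF zero_less _ K conj])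
  show "\<exists>g \<in> carrier G. act g 0 = j" if "j < p" for j
    using kernel_transitive[OF zero_less that] kernelD by blast
qed (use assms in auto)

section \<open>The stabilizer of the vertex \<open>0\<close> and its virtual endomorphism\<close>

abbreviation "H \<equiv> {g \<in> carrier G. act g 0 = 0}"

lemma stabilizer_mult: "\<lbrakk>g \<in> H; h \<in> H\<rbrakk> \<Longrightarrow> g \<otimes> h \<in> H"
  using zero_less by (simp add: act_mult)

lemma stabilizer_inv: "g \<in> H \<Longrightarrow> inv g \<in> H"
  using zero_less by (simp add: act_inv_fixed)

lemma stabilizer_pow: "g \<in> H \<Longrightarrow> g [^] (n::nat) \<in> H"
  using zero_less by (simp add: act_pow_fixed)

lemma stabilizer_comm: "\<lbrakk>g \<in> H; a \<in> H\<rbrakk> \<Longrightarrow> comm g a \<in> H"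
  unfolding comm_def by (intro stabilizer_mult stabilizer_inv)

lemma sect_stabilizer_closed: "g \<in> H \<Longrightarrow> sect g 0 \<in> carrier G"
  using sect_closed zero_less by simp

lemma sect_stabilizer_mult: "\<lbrakk>g \<in> H; h \<in> H\<rbrakk> \<Longrightarrow> sect (g \<otimes> h) 0 = sect g 0 \<otimes> sect h 0"
  using zero_less by (simp add: sect_mult)

lemma sect_stabilizer_inv: "g \<in> H \<Longrightarrow> sect (inv g) 0 = inv (sect g 0)"
  using zero_less by (simp add: sect_inv)

lemma sect_stabilizer_pow: "g \<in> H \<Longrightarrow> sect (g [^] (n::nat)) 0 = sect g 0 [^] n"
  using zero_less by (simp add: sect_pow)

lemma sect_stabilizer_comm:
  assumes "g \<in> H" "a \<in> H"
  shows "sect (comm g a) 0 = comm (sect g 0) (sect a 0)"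
  using assms stabilizer_mult stabilizer_inv
  by (simp only: comm_def sect_stabilizer_mult sect_stabilizer_inv)

text \<open>The power acts trivially on the first level by \<open>act_fact_pow\<close>, so there the
  commutator acts as \<open>a\<close> followed by its inverse.\<close>

lemma comm_pow_stabilizer:
  assumes "g \<in> carrier G" "a \<in> A"
  shows "comm (g [^] (fact p :: nat)) a \<in> H"
proof -
  let ?u = "g [^] (fact p :: nat)"
  have a: "a \<in> carrier G"
    using assms kernelD by simp
  have u: "act ?u i = i" "act (inv ?u) i = i" if "i < p" for i
    using that assms act_fact_pow act_inv_fixed by simp_all
  have "act (comm ?u a) 0 = 0"
    using a assms u zero_less act_less act_inv by (simp add: comm_def act_mult)
  then show ?thesis
    using a assms by simp
qed

text \<open>By \<open>torsion\<close> the power stays outside the kernel, so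
  \<open>centralizer\<close> applies. Supplies the nontrivial elements that contradict
  \<open>core_trivial\<close>.\<close>

lemma exists_noncommuting: "\<exists>g \<in> carrier G. \<exists>a \<in> A. comm (g [^] (fact p :: nat)) a \<noteq> \<one>"
proof -
  obtain g a where "g \<in> carrier G" "g \<notin> A" "a \<in> A" "a \<noteq> \<one>"
    using kernel_nontrivial quotient_nontrivial by blast
  then show ?thesis
    using centralizer[of "g [^] (fact p :: nat)" a] torsion[of g "fact p"] by force
qed

text \<open>As the kernel is abelian, taking sections at \<open>0\<close> kills the image of
  \<open>A \<inter> H\<close> under \<open>comm h\<close>. By \<open>core_trivial\<close> this image
  is trivial, so \<open>h\<close> centralizes a nontrivial kernel element, against
  \<open>centralizer\<close>.\<close>

lemma virtual_endomorphism_injective_mod_kernel: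
  assumes h: "h \<in> H" and "sect h 0 \<in> A"
  shows "h \<in> A"
proof (rule ccontr)
  assume "h \<notin> A"
  define K where "K = comm h ` (A \<inter> H)"
  have "K \<subseteq> {\<one>}"
  proof (rule core_trivial)
    show "K \<subseteq> carrier G"
      using h kernelD by (auto simp: K_def)
  next
    fix k g assume "k \<in> K" and g: "g \<in> carrier G"
    then obtain a where a: "k = comm h a" "a \<in> A" "a \<in> H"
      by (auto simp: K_def)
    \<comment> \<open>An element of \<open>H\<close> is required for conjugation to preserve
      \<open>A \<inter> H\<close>; on the kernel it acts as \<open>g\<close> does.\<close>
    obtain g' where g': "g' \<in> H" "\<pi> g' = \<pi> g"
      using exists_stabilizing[OF g] by auto
    have "g \<otimes> k \<otimes> inv g = g' \<otimes> k \<otimes> inv g'"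
      using g g' a h by (intro conj_eq_of_image_eq) auto
    also have "\<dots> = comm h (g' \<otimes> a \<otimes> inv g')"
      using g' a h by (simp add: conj_comm_kernel)
    finally have eq: "g \<otimes> k \<otimes> inv g = comm h (g' \<otimes> a \<otimes> inv g')" .
    have "g' \<otimes> a \<otimes> inv g' \<in> A \<inter> H"
      using g' a kernel_conj[of g' a] stabilizer_mult[OF stabilizer_mult[OF g'(1) a(3)] stabilizer_inv[OF g'(1)]]
      by blast
    then show "g \<otimes> k \<otimes> inv g \<in> K"
      unfolding K_def eq by blast
  next
    fix k assume "k \<in> K"
    then obtain a where a: "k = comm h a" "a \<in> A" "a \<in> H"
      by (auto simp: K_def)
    show "act k 0 = 0"
      using stabilizer_comm[OF h a(3)] unfolding a(1) by simp
    have "sect k 0 = comm (sect h 0) (sect a 0)"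
      unfolding a(1) using h a(3) by (rule sect_stabilizer_comm)
    \<comment> \<open>The trivial element is written so as to exhibit it as a member of
      \<open>K\<close>.\<close>
    also have "\<dots> = comm h \<one>"
      using a h assms(2) zero_less sect_kernel comm_kernel_kernel by simp
    finally have "sect k 0 = comm h \<one>" .
    moreover have "\<one> \<in> A \<inter> H"
      using zero_less by (simp add: kernel_def act_one)
    ultimately show "sect k 0 \<in> K"
      unfolding K_def by blast
  qed
  moreover obtain g a where ga: "g \<in> carrier G" "a \<in> A" "comm (g [^] (fact p :: nat)) a \<noteq> \<one>"
    using exists_noncommuting by blast
  moreover have "comm (g [^] (fact p :: nat)) a \<in> A \<inter> H"
    using comm_pow_stabilizer[OF ga(1,2)] ga(1,2) by (intro IntI comm_kernel) simp_all
  ultimately have "comm h (comm (g [^] (fact p :: nat)) a) = \<one>"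
    unfolding K_def by blast
  then show False
    using centralizer[OF _ \<open>h \<notin> A\<close>] h ga by force
qed

text \<open>A relation between the images of the sections puts the section of
  \<open>g [^] i \<otimes> inv (h [^] j)\<close> into the kernel; injectivity modulo the kernel
  pulls the relation back.\<close>

lemma virtual_endomorphism_independent:
  assumes "g \<in> H" "h \<in> H" "mult_independent Q (\<pi> g) (\<pi> h)"
  shows "mult_independent Q (\<pi> (sect g 0)) (\<pi> (sect h 0))"
  unfolding mult_independent_def
proof (intro allI impI)
  have int_pow: "x [^] (i::int) \<in> H \<and> sect (x [^] i) 0 = sect x 0 [^] i" if "x \<in> H" for x i
    using stabilizer_inv[OF stabilizer_pow[OF that]] stabilizer_pow[OF that]
      sect_stabilizer_inv[OF stabilizer_pow[OF that]] sect_stabilizer_pow[OF that]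
    unfolding int_pow_def2 by presburger
  fix i j :: int
  assume eq: "\<pi> (sect g 0) [^]\<^bsub>Q\<^esub> i = \<pi> (sect h 0) [^]\<^bsub>Q\<^esub> j"
  let ?k = "g [^] i \<otimes> inv (h [^] j)"
  have k: "?k \<in> H"
    using assms int_pow by (intro stabilizer_mult stabilizer_inv) blast+
  have "sect ?k 0 = sect g 0 [^] i \<otimes> inv (sect h 0 [^] j)"
    using assms(1,2) int_pow stabilizer_inv by (simp only: sect_stabilizer_mult sect_stabilizer_inv)
  then have "sect ?k 0 \<in> A"
    using eq assms(1,2) sect_stabilizer_closed by (simp add: kernel_iff hom_int_pow)
  then have "?k \<in> A"
    using k virtual_endomorphism_injective_mod_kernel by blast
  then have "\<pi> g [^]\<^bsub>Q\<^esub> i = \<pi> h [^]\<^bsub>Q\<^esub> j"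
    using assms(1,2) Q.inv_solve_right'[of "\<one>\<^bsub>Q\<^esub>" "\<pi> g [^]\<^bsub>Q\<^esub> i" "\<pi> h [^]\<^bsub>Q\<^esub> j"]
    by (simp add: kernel_iff hom_int_pow)
  then show "i = 0 \<and> j = 0"
    using assms(3) unfolding mult_independent_def by fastforce
qed

section \<open>Invariance of the commutators with \<open>p!\<close>-th powers\<close>

lemma independent_pow:
  assumes "x \<in> carrier Q" "y \<in> carrier Q" "mult_independent Q x y" "0 < (n::nat)"
  shows "mult_independent Q (x [^]\<^bsub>Q\<^esub> n) (y [^]\<^bsub>Q\<^esub> n)"
  unfolding mult_independent_def
proof (intro allI impI)
  fix i j :: int
  assume "(x [^]\<^bsub>Q\<^esub> n) [^]\<^bsub>Q\<^esub> i = (y [^]\<^bsub>Q\<^esub> n) [^]\<^bsub>Q\<^esub> j"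
  then have "x [^]\<^bsub>Q\<^esub> (int n * i) = y [^]\<^bsub>Q\<^esub> (int n * j)"
    using assms(1,2) by (simp add: int_pow_int flip: Q.int_pow_pow)
  then show "i = 0 \<and> j = 0"
    using assms(3,4) unfolding mult_independent_def by fastforce
qed

text \<open>Gives the invariance under sections needed in \<open>no_such_action\<close>; rank two
  enters through an auxiliary \<open>g\<close> independent of \<open>h\<close>.\<close>

lemma sect_comm_pow:
  assumes h: "h \<in> H" "h \<notin> A" and a: "a \<in> A"
  shows "\<exists>c \<in> A. sect (comm (h [^] (fact p :: nat)) a) 0 = comm (sect h 0 [^] (fact p :: nat)) c"
proof -
  let ?m = "fact p :: nat"
  obtain g where "g \<in> carrier G" "mult_independent Q (\<pi> h) (\<pi> g)"
    using exists_independent h by blast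
  \<comment> \<open>Independence is symmetric and depends only on images, so the partner may be
    taken in \<open>H\<close>.\<close>
  then obtain g where g: "g \<in> H" "mult_independent Q (\<pi> g) (\<pi> h)"
    using exists_stabilizing[of g] by (auto simp: mult_independent_def) metis
  let ?u = "h [^] ?m" and ?v = "g [^] ?m"
  have uv: "?u \<in> H" "?v \<in> H"
    using g h stabilizer_pow by blast+
  have I: "comm ?u a \<in> H" "comm ?v a \<in> H" "comm ?u a \<in> A" "comm ?v a \<in> A"
    using g h a comm_pow_stabilizer by simp_all
  have "mult_independent Q (\<pi> ?v) (\<pi> ?u)"
    using independent_pow[of "\<pi> g" "\<pi> h" ?m] g h by (simp add: hom_nat_pow)
  then have ind: "mult_independent Q (\<pi> (sect ?v 0)) (\<pi> (sect ?u 0))"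
    using uv virtual_endomorphism_independent by blast
  \<comment> \<open>Both inner commutators lie in \<open>H\<close>, so sections may be taken on
    either side of \<open>(v - 1) (u - 1) a = (u - 1) (v - 1) a\<close>.\<close>
  have "comm ?v (comm ?u a) = comm ?u (comm ?v a)"
    using uv a by (intro comm_left_commute) auto
  then have "comm (sect ?v 0) (sect (comm ?u a) 0) = comm (sect ?u 0) (sect (comm ?v a) 0)"
    by (simp only: sect_stabilizer_comm[OF uv(2) I(1), symmetric] sect_stabilizer_comm[OF uv(1) I(2), symmetric])
  moreover have "sect (comm ?u a) 0 \<in> A" "sect (comm ?v a) 0 \<in> A"
    using I sect_kernel zero_less by auto
  \<comment> \<open>By \<open>comm_divisible\<close> the operator of \<open>sect ?v 0\<close>
    cancels modulo the image of the operator of \<open>sect ?u 0\<close>.\<close>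
  ultimately have "\<exists>c \<in> A. sect (comm ?u a) 0 = comm (sect ?u 0) c"
    using comm_divisible[OF _ _ ind] sect_stabilizer_closed uv by blast
  then show ?thesis
    using h sect_stabilizer_pow by simp
qed

theorem no_such_action: False
proof -
  let ?m = "fact p :: nat"
  define K where "K = {comm (g [^] ?m) a | g a. g \<in> carrier G \<and> a \<in> A}"
  have "K \<subseteq> {\<one>}"
  proof (rule core_trivial)
    show "K \<subseteq> carrier G"
      using kernelD by (auto simp: K_def)
  next
    fix k x assume "k \<in> K" and x: "x \<in> carrier G"
    then obtain g a where ga: "k = comm (g [^] ?m) a" "g \<in> carrier G" "a \<in> A"
      by (auto simp: K_def)
    then have "x \<otimes> k \<otimes> inv x = comm (g [^] ?m) (x \<otimes> a \<otimes> inv x)"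
      using x by (simp add: conj_comm_kernel)
    then show "x \<otimes> k \<otimes> inv x \<in> K"
      using kernel_conj[OF x ga(3)] ga(2) unfolding K_def by blast
  next
    fix k assume "k \<in> K"
    then obtain g a where ga: "k = comm (g [^] ?m) a" "g \<in> carrier G" "a \<in> A"
      by (auto simp: K_def)
    show "act k 0 = 0"
      using ga comm_pow_stabilizer by simp
    \<comment> \<open>On the kernel \<open>comm\<close> depends only on the image of its first
      argument, so \<open>g\<close> may be replaced by an element of \<open>H\<close>.\<close>
    obtain h where h: "h \<in> H" "\<pi> h = \<pi> g"
      using exists_stabilizing[OF ga(2)] by auto
    have k: "k = comm (h [^] ?m) a"
      unfolding ga(1) using h ga by (intro comm_eq_of_image_eq) (simp_all add: hom_nat_pow)
    show "sect k 0 \<in> K"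
    proof (cases "h \<in> A")
      case True
      \<comment> \<open>Here \<open>k\<close> and its section are trivial; the section is written as
        a commutator with a power of \<open>\<one>\<close> to lie in \<open>K\<close>.\<close>
      then have "h [^] ?m \<in> A"
        by (simp add: kernel_def hom_nat_pow)
      then have "sect k 0 = comm (\<one> [^] ?m) \<one>"
        using comm_kernel_kernel[OF _ ga(3)] zero_less unfolding k by (simp add: sect_one)
      moreover have "\<one> \<in> A"
        by (simp add: kernel_def)
      ultimately show ?thesis
        unfolding K_def by blast
    next
      case False
      then show ?thesis
        using sect_comm_pow[OF h(1) False ga(3)] sect_stabilizer_closed[OF h(1)]
        unfolding k K_def by blast
    qed
  qed
  then show False
    using exists_noncommuting by (auto simp: K_def)
qed

end

section \<open>State-closed representations\<close>

text \<open>State-closedness puts every state of \<open>\<phi> g\<close> into the image of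
  \<open>\<phi>\<close>, and injectivity makes its preimage, the abstract section, unique.\<close>

lemma self_similar_action_of_representation:
  fixes G (structure)
  assumes G: "group G" and \<phi>: "faithful_state_closed_representation m G \<phi>"
  shows "self_similar_action G m (\<lambda>g i. hd (\<phi> g [i]))
    (\<lambda>g i. inv_into (carrier G) \<phi> (tree_section m (\<phi> g) i))"
proof -
  interpret group G by (rule G)
  let ?V = "tree_vertices m"
  let ?act = "\<lambda>g i. hd (\<phi> g [i])"
  let ?sect = "\<lambda>g i. inv_into (carrier G) \<phi> (tree_section m (\<phi> g) i)"
  have hom: "\<phi> \<in> hom G (tree_aut_group m)" and inj: "inj_on \<phi> (carrier G)"
    and states: "g \<in> carrier G \<Longrightarrow> states m (\<phi> g) \<subseteq> \<phi> ` carrier G" for g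
    using \<phi> by (auto simp: faithful_state_closed_representation_def
        state_closed_representation_def state_closed_def)
  interpret \<phi>: group_hom G "tree_aut_group m" \<phi>
    by (rule group_hom.intro[OF G group_tree_aut_group]) (rule group_hom_axioms.intro[OF hom])
  have aut: "\<phi> g \<in> tree_automorphisms m" if "g \<in> carrier G" for g
    using \<phi>.hom_closed[OF that] by (simp add: tree_aut_group_def)
  have ext: "\<phi> g \<in> extensional ?V" if "g \<in> carrier G" for g
    using aut[OF that] by (simp add: tree_automorphisms_def Bij_imp_extensional)
  have mult: "\<phi> (g \<otimes> h) v = \<phi> h (\<phi> g v)"
    if "g \<in> carrier G" "h \<in> carrier G" "v \<in> ?V" for g h v
    using that \<phi>.hom_mult[of g h] by (simp add: tree_aut_group_def compose_eq)
  have one: "\<phi> \<one> = (\<lambda>v \<in> ?V. v)"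
    using \<phi>.hom_one by (simp add: tree_aut_group_def)
  have sect: "?sect g i \<in> carrier G" "\<phi> (?sect g i) = tree_section m (\<phi> g) i"
    if "g \<in> carrier G" "i < m" for g i
  proof -
    have "tree_section m (\<phi> g) i \<in> \<phi> ` carrier G"
      using that states[OF that(1)] states.step[OF states.self] by blast
    then show "?sect g i \<in> carrier G" "\<phi> (?sect g i) = tree_section m (\<phi> g) i"
      by (simp_all add: inv_into_into f_inv_into_f)
  qed
  have act_less: "?act g i < m" if "g \<in> carrier G" "i < m" for g i
    using bij_betwE[OF tree_level_one_permutation[OF aut[OF that(1)]]] that(2) by simp
  have apply_Cons: "\<phi> g (i # w) = ?act g i # \<phi> (?sect g i) w"
    if "g \<in> carrier G" "i < m" "w \<in> ?V" for g i w
    unfolding sect(2)[OF that(1,2)] by (rule tree_automorphism_Cons(1)[OF aut[OF that(1)] that(2,3)])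
  have singleton: "\<phi> g [i] = [?act g i]" if "g \<in> carrier G" "i < m" for g i
    using tree_automorphism_Cons(2)[OF aut[OF that(1)] that(2), of "[]"] by simp
  have in_V: "\<phi> g v \<in> ?V" if "g \<in> carrier G" "v \<in> ?V" for g v
    using tree_automorphism_in_vertices[OF aut] that by blast
  show ?thesis
  proof
    fix g h i
    assume g: "g \<in> carrier G" and h: "h \<in> carrier G" and i: "i < m"
    show "?act (g \<otimes> h) i = ?act h (?act g i)"
      using mult[OF g h, of "[i]"] i singleton[OF g i] by simp
    \<comment> \<open>Both sides are compared through \<open>\<phi>\<close>: the tails of the image
      of \<open>i # w\<close> give \<open>(g h)_i = g_i h_j\<close>, where \<open>g\<close> sends
      \<open>i\<close> to \<open>j\<close>.\<close>
    show "?sect (g \<otimes> h) i = ?sect g i \<otimes> ?sect h (?act g i)"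
    proof (rule inj_onD[OF inj])
      show "\<phi> (?sect (g \<otimes> h) i) = \<phi> (?sect g i \<otimes> ?sect h (?act g i))"
      proof (rule extensionalityI[where A = ?V])
        fix w assume w: "w \<in> ?V"
        have "\<phi> (?sect (g \<otimes> h) i) w = tl (\<phi> (g \<otimes> h) (i # w))"
          using apply_Cons[of "g \<otimes> h" i w] g h i w by simp
        also have "\<dots> = tl (\<phi> h (\<phi> g (i # w)))"
          using mult[OF g h, of "i # w"] i w by (simp del: \<phi>.hom_mult)
        also have "\<dots> = \<phi> (?sect h (?act g i)) (\<phi> (?sect g i) w)"
          using apply_Cons[OF g i w] apply_Cons[OF h act_less[OF g i] in_V[OF sect(1)[OF g i] w]] by simp
        also have "\<dots> = \<phi> (?sect g i \<otimes> ?sect h (?act g i)) w"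
          using mult[OF sect(1)[OF g i] sect(1)[OF h act_less[OF g i]] w] by simp
        finally show "\<phi> (?sect (g \<otimes> h) i) w = \<phi> (?sect g i \<otimes> ?sect h (?act g i)) w" .
      qed (intro ext sect(1) m_closed act_less g h i)+
    qed (intro sect(1) m_closed act_less g h i)+
  next
    fix K
    assume K: "K \<subseteq> carrier G" and fixed: "\<And>k i. \<lbrakk>k \<in> K; i < m\<rbrakk> \<Longrightarrow> ?act k i = i \<and> ?sect k i \<in> K"
    \<comment> \<open>Induction on the vertex for all \<open>k\<close> in \<open>K\<close> at once:
      \<open>k\<close> fixes the first letter, and the tail is moved by a section that lies in
      \<open>K\<close> again.\<close>
    have "\<phi> k v = v" if "k \<in> K" "v \<in> ?V" for k v
      using that
    proof (induction v arbitrary: k)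
      case Nil
      then show ?case
        using aut[of k] K by (auto simp: tree_automorphisms_def)
    next
      case (Cons i w)
      then have i: "i < m" and w: "w \<in> ?V"
        by auto
      have "\<phi> k (i # w) = ?act k i # \<phi> (?sect k i) w"
        using Cons.prems(1) K i w by (intro apply_Cons) auto
      then show ?case
        using fixed[OF Cons.prems(1) i] Cons.IH[OF _ w] by simp
    qed
    then have "\<phi> k = \<phi> \<one>" if "k \<in> K" for k
      using that K by (intro extensionalityI[where A = ?V]) (auto simp: one ext simp del: \<phi>.hom_one)
    then show "K \<subseteq> {\<one>}"
      using K inj_onD[OF inj _ _ one_closed] by blast
  qed (use act_less sect one in auto)
qed

section \<open>Wreath products\<close>

text \<open>The independent partners stand in for freeness of rank at least two; they also make
  \<open>Q\<close> torsion-free.\<close>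

locale wreath = C: comm_group C + Q: comm_group Q
  for C :: "('a, 'b) monoid_scheme" and Q :: "('c, 'd) monoid_scheme" +
  assumes exists_independent: "\<lbrakk>x \<in> carrier Q; x \<noteq> \<one>\<^bsub>Q\<^esub>\<rbrakk> \<Longrightarrow> \<exists>y \<in> carrier Q. mult_independent Q x y"
begin

abbreviation "N \<equiv> sum_group (carrier Q) (\<lambda>_. C)"
abbreviation "\<theta> \<equiv> shift_action C Q"
abbreviation "W \<equiv> restricted_wreath_product C Q"

lemma base_carrier: "carrier N = {a \<in> carrier Q \<rightarrow>\<^sub>E carrier C. finite {w \<in> carrier Q. a w \<noteq> \<one>\<^bsub>C\<^esub>}}"
  by (simp add: carrier_sum_group C.group_axioms)

lemma base_closed [simp]: "\<lbrakk>a \<in> carrier N; w \<in> carrier Q\<rbrakk> \<Longrightarrow> a w \<in> carrier C"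
  by (auto simp: base_carrier)

lemma base_eqI:
  assumes "a \<in> carrier N" "b \<in> carrier N" "\<And>w. w \<in> carrier Q \<Longrightarrow> a w = b w"
  shows "a = b"
  using assms by (auto simp: base_carrier intro: PiE_ext)

sublocale N: comm_group N
proof (rule group.group_comm_groupI)
  show "group N"
    by (simp add: C.group_axioms)
  show "a \<otimes>\<^bsub>N\<^esub> b = b \<otimes>\<^bsub>N\<^esub> a" if "a \<in> carrier N" "b \<in> carrier N" for a b
    using that by (auto simp: C.m_comm intro: restrict_ext)
qed

sublocale W: group W
  by (intro group_restricted_wreath_product C.group_axioms Q.group_axioms)

lemma base_mult_apply: "w \<in> carrier Q \<Longrightarrow> (a \<otimes>\<^bsub>N\<^esub> b) w = a w \<otimes>\<^bsub>C\<^esub> b w"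
  by simp

lemma base_inv_apply: "\<lbrakk>a \<in> carrier N; w \<in> carrier Q\<rbrakk> \<Longrightarrow> (inv\<^bsub>N\<^esub> a) w = inv\<^bsub>C\<^esub> (a w)"
  by (simp add: C.group_axioms)

lemma shift_apply:
  "\<lbrakk>a \<in> carrier N; w \<in> carrier Q\<rbrakk> \<Longrightarrow> \<theta> x a w = a (inv\<^bsub>Q\<^esub> x \<otimes>\<^bsub>Q\<^esub> w)"
  by (simp add: shift_action_def)

lemma shift_hom:
  assumes "x \<in> carrier Q"
  shows "\<theta> x \<in> hom N N"
proof -
  have "\<theta> x \<in> carrier (AutoGroup N)"
    using assms shift_action_hom[OF C.group_axioms Q.group_axioms] by (auto simp: hom_def)
  then show ?thesis
    by (simp add: AutoGroup_def auto_def)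
qed

lemma shift_closed: "\<lbrakk>x \<in> carrier Q; a \<in> carrier N\<rbrakk> \<Longrightarrow> \<theta> x a \<in> carrier N"
  using shift_hom by (auto simp: hom_def)

lemma shift_mult:
  "\<lbrakk>x \<in> carrier Q; a \<in> carrier N; b \<in> carrier N\<rbrakk> \<Longrightarrow> \<theta> x (a \<otimes>\<^bsub>N\<^esub> b) = \<theta> x a \<otimes>\<^bsub>N\<^esub> \<theta> x b"
  using shift_hom by (auto simp: hom_def)

lemma shift_inv:
  assumes "x \<in> carrier Q" "a \<in> carrier N"
  shows "\<theta> x (inv\<^bsub>N\<^esub> a) = inv\<^bsub>N\<^esub> (\<theta> x a)"
proof -
  interpret group_hom N N "\<theta> x"
    using assms shift_hom by unfold_locales
  show ?thesis
    using assms(2) by (rule hom_inv)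
qed

lemma shift_shift:
  assumes "x \<in> carrier Q" "y \<in> carrier Q" "a \<in> carrier N"
  shows "\<theta> x (\<theta> y a) = \<theta> (x \<otimes>\<^bsub>Q\<^esub> y) a"
  using assms
  by (intro base_eqI) (simp_all add: shift_closed shift_apply Q.inv_mult_group Q.m_assoc)

lemma shift_one: "a \<in> carrier N \<Longrightarrow> \<theta> \<one>\<^bsub>Q\<^esub> a = a"
  by (intro base_eqI) (simp_all add: shift_closed shift_apply)

section \<open>Infinite orbits and fixed points in the base group\<close>

lemma inj_pow:
  assumes "x \<in> carrier Q" "x \<noteq> \<one>\<^bsub>Q\<^esub>"
  shows "inj (\<lambda>n::nat. x [^]\<^bsub>Q\<^esub> n)"
proof (rule injI)
  fix k l :: nat
  assume eq: "x [^]\<^bsub>Q\<^esub> k = x [^]\<^bsub>Q\<^esub> l"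
  obtain y where y: "y \<in> carrier Q" "mult_independent Q x y"
    using exists_independent assms by blast
  have "x [^]\<^bsub>Q\<^esub> (int k - int l) = y [^]\<^bsub>Q\<^esub> (0::int)"
    using assms eq by (simp add: Q.int_pow_diff int_pow_int)
  then show "k = l"
    using y(2) unfolding mult_independent_def by fastforce
qed

text \<open>A fixed function is constant along the powers of \<open>x\<close>, which give infinitely
  many points, while its support is finite.\<close>

lemma shift_fixed:
  assumes x: "x \<in> carrier Q" "x \<noteq> \<one>\<^bsub>Q\<^esub>" and a: "a \<in> carrier N" "\<theta> x a = a"
  shows "a = \<one>\<^bsub>N\<^esub>"
proof (rule base_eqI)
  fix w assume w: "w \<in> carrier Q"
  have step: "a (x \<otimes>\<^bsub>Q\<^esub> v) = a v" if "v \<in> carrier Q" for v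
    using shift_apply[OF a(1), of "x \<otimes>\<^bsub>Q\<^esub> v" x] a(2) x that by simp
  have orbit: "a (x [^]\<^bsub>Q\<^esub> (n::nat) \<otimes>\<^bsub>Q\<^esub> w) = a w" for n
  proof (induction n)
    case (Suc n)
    have "x [^]\<^bsub>Q\<^esub> Suc n \<otimes>\<^bsub>Q\<^esub> w = x \<otimes>\<^bsub>Q\<^esub> (x [^]\<^bsub>Q\<^esub> n \<otimes>\<^bsub>Q\<^esub> w)"
      using x w by (simp only: Q.nat_pow_Suc2 Q.m_assoc Q.nat_pow_closed)
    then show ?case
      using Suc step[of "x [^]\<^bsub>Q\<^esub> n \<otimes>\<^bsub>Q\<^esub> w"] x w by simp
  qed (use w in simp)
  have "inj (\<lambda>n::nat. x [^]\<^bsub>Q\<^esub> n \<otimes>\<^bsub>Q\<^esub> w)"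
    using inj_pow[OF x] x w by (auto simp: inj_on_def)
  then have inf: "infinite (range (\<lambda>n::nat. x [^]\<^bsub>Q\<^esub> n \<otimes>\<^bsub>Q\<^esub> w))"
    by (rule range_inj_infinite)
  have "a w = \<one>\<^bsub>C\<^esub>"
  proof (rule ccontr)
    assume "a w \<noteq> \<one>\<^bsub>C\<^esub>"
    then have "range (\<lambda>n::nat. x [^]\<^bsub>Q\<^esub> n \<otimes>\<^bsub>Q\<^esub> w) \<subseteq> {w \<in> carrier Q. a w \<noteq> \<one>\<^bsub>C\<^esub>}"
      using x w orbit by auto
    then show False
      using inf a(1) finite_subset by (auto simp: base_carrier)
  qed
  then show "a w = \<one>\<^bsub>N\<^esub> w"
    using w by simp
qed (use a N.one_closed in blast)+

section \<open>The group ring elements \<open>x - 1\<close> acting on the base group\<close>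

definition diff :: "'c \<Rightarrow> ('c \<Rightarrow> 'a) \<Rightarrow> 'c \<Rightarrow> 'a"
  where "diff x a = \<theta> x a \<otimes>\<^bsub>N\<^esub> inv\<^bsub>N\<^esub> a"

lemma diff_closed: "\<lbrakk>x \<in> carrier Q; a \<in> carrier N\<rbrakk> \<Longrightarrow> diff x a \<in> carrier N"
  unfolding diff_def by (intro N.m_closed N.inv_closed shift_closed)

lemma diff_apply:
  assumes "x \<in> carrier Q" "a \<in> carrier N" "w \<in> carrier Q"
  shows "diff x a w = a (inv\<^bsub>Q\<^esub> x \<otimes>\<^bsub>Q\<^esub> w) \<otimes>\<^bsub>C\<^esub> inv\<^bsub>C\<^esub> a w"
  using assms unfolding diff_def by (simp only: base_mult_apply base_inv_apply shift_apply)

lemma diff_mult: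
  assumes "x \<in> carrier Q" "a \<in> carrier N" "b \<in> carrier N"
  shows "diff x (a \<otimes>\<^bsub>N\<^esub> b) = diff x a \<otimes>\<^bsub>N\<^esub> diff x b"
  using assms unfolding diff_def
  by (simp only: shift_mult N.inv_mult N.m_ac shift_closed N.m_closed N.inv_closed)

lemma shift_diff:
  assumes "x \<in> carrier Q" "y \<in> carrier Q" "a \<in> carrier N"
  shows "\<theta> x (diff y a) = diff y (\<theta> x a)"
  using assms unfolding diff_def
  by (simp only: shift_mult shift_inv shift_shift shift_closed N.inv_closed Q.m_comm)

text \<open>The group ring identity \<open>x y - 1 = x (y - 1) + (x - 1)\<close>.\<close>

lemma diff_mult_left:
  assumes "x \<in> carrier Q" "y \<in> carrier Q" "a \<in> carrier N"
  shows "diff (x \<otimes>\<^bsub>Q\<^esub> y) a = \<theta> x (diff y a) \<otimes>\<^bsub>N\<^esub> diff x a"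
proof -
  have "\<theta> x (diff y a) \<otimes>\<^bsub>N\<^esub> diff x a =
      \<theta> (x \<otimes>\<^bsub>Q\<^esub> y) a \<otimes>\<^bsub>N\<^esub> (inv\<^bsub>N\<^esub> \<theta> x a \<otimes>\<^bsub>N\<^esub> (\<theta> x a \<otimes>\<^bsub>N\<^esub> inv\<^bsub>N\<^esub> a))"
    using assms unfolding diff_def
    by (simp only: shift_mult shift_inv shift_shift shift_closed N.inv_closed N.m_assoc N.m_closed
        Q.m_closed)
  also have "\<dots> = diff (x \<otimes>\<^bsub>Q\<^esub> y) a"
    using assms unfolding diff_def
    by (simp only: N.inv_cancel_left shift_closed N.inv_closed)
  finally show ?thesis ..
qed

text \<open>Since \<open>x - 1\<close> divides \<open>x^n - 1\<close>, divisibility by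
  \<open>y - 1\<close> carries over. In the induction, additively, the next witness is
  \<open>x c + b\<close>.\<close>

lemma diff_pow:
  assumes "x \<in> carrier Q" "y \<in> carrier Q" "a \<in> carrier N" "b \<in> carrier N" "diff x a = diff y b"
  shows "\<exists>c \<in> carrier N. diff (x [^]\<^bsub>Q\<^esub> (n::nat)) a = diff y c"
proof (induction n)
  case 0
  have "diff (x [^]\<^bsub>Q\<^esub> (0::nat)) a = diff y \<one>\<^bsub>N\<^esub>"
  proof (rule base_eqI)
    show "diff (x [^]\<^bsub>Q\<^esub> (0::nat)) a w = diff y \<one>\<^bsub>N\<^esub> w" if "w \<in> carrier Q" for w
      using assms that N.one_closed diff_apply[of "\<one>\<^bsub>Q\<^esub>" a w] diff_apply[of y "\<one>\<^bsub>N\<^esub>" w] by simp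
  qed (use assms in \<open>auto intro!: diff_closed N.one_closed simp del: one_sum_group\<close>)
  then show ?case
    using N.one_closed by blast
next
  case (Suc n)
  then obtain c where c: "c \<in> carrier N" "diff (x [^]\<^bsub>Q\<^esub> n) a = diff y c"
    by blast
  have "diff (x [^]\<^bsub>Q\<^esub> Suc n) a = \<theta> x (diff (x [^]\<^bsub>Q\<^esub> n) a) \<otimes>\<^bsub>N\<^esub> diff x a"
    unfolding Q.nat_pow_Suc2[OF assms(1)] using assms by (intro diff_mult_left) auto
  also have "\<dots> = diff y (\<theta> x c \<otimes>\<^bsub>N\<^esub> b)"
    using assms c by (simp only: shift_diff diff_mult shift_closed)
  finally show ?case
    using N.m_closed[OF shift_closed[OF assms(1) c(1)] assms(4)] by blast
qed

text \<open>Each pair \<open>s, t\<close> excludes at most one \<open>n\<close>: two such exponents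
  would make a nontrivial power of \<open>x\<close> a power of \<open>y\<close>. Finitely many pairs
  leave some \<open>n\<close>.\<close>

lemma exists_escaping_power:
  assumes x: "x \<in> carrier Q" and y: "y \<in> carrier Q" and ind: "mult_independent Q x y"
    and S: "finite S" "S \<subseteq> carrier Q"
  shows "\<exists>n::nat. \<forall>s \<in> S. \<forall>t \<in> S. \<forall>k::int. x [^]\<^bsub>Q\<^esub> n \<otimes>\<^bsub>Q\<^esub> s \<noteq> y [^]\<^bsub>Q\<^esub> k \<otimes>\<^bsub>Q\<^esub> t"
proof -
  define B where "B s t = {n::nat. \<exists>k::int. x [^]\<^bsub>Q\<^esub> n \<otimes>\<^bsub>Q\<^esub> s = y [^]\<^bsub>Q\<^esub> k \<otimes>\<^bsub>Q\<^esub> t}" for s t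
  have "finite (B s t)" if st: "s \<in> S" "t \<in> S" for s t
  proof -
    have "m = n" if "m \<in> B s t" "n \<in> B s t" for m n
    proof -
      from that obtain k l :: int
        where eq: "x [^]\<^bsub>Q\<^esub> m \<otimes>\<^bsub>Q\<^esub> s = y [^]\<^bsub>Q\<^esub> k \<otimes>\<^bsub>Q\<^esub> t" "x [^]\<^bsub>Q\<^esub> n \<otimes>\<^bsub>Q\<^esub> s = y [^]\<^bsub>Q\<^esub> l \<otimes>\<^bsub>Q\<^esub> t"
        by (auto simp: B_def)
      have st: "s \<in> carrier Q" "t \<in> carrier Q"
        using st S by auto
      have pow: "z = v \<otimes>\<^bsub>Q\<^esub> (t \<otimes>\<^bsub>Q\<^esub> inv\<^bsub>Q\<^esub> s)"
        if "z \<otimes>\<^bsub>Q\<^esub> s = v \<otimes>\<^bsub>Q\<^esub> t" "z \<in> carrier Q" "v \<in> carrier Q" for z v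
        using that st Q.inv_solve_right[of z "v \<otimes>\<^bsub>Q\<^esub> t" s] by (simp add: Q.m_assoc)
      let ?u = "t \<otimes>\<^bsub>Q\<^esub> inv\<^bsub>Q\<^esub> s"
      have u: "?u \<in> carrier Q"
        using st by simp
      have m: "x [^]\<^bsub>Q\<^esub> int m = y [^]\<^bsub>Q\<^esub> k \<otimes>\<^bsub>Q\<^esub> ?u" and n: "x [^]\<^bsub>Q\<^esub> int n = y [^]\<^bsub>Q\<^esub> l \<otimes>\<^bsub>Q\<^esub> ?u"
        using pow[OF eq(1)] pow[OF eq(2)] x y by (simp_all add: int_pow_int)
      have "x [^]\<^bsub>Q\<^esub> (int m - int n) = (y [^]\<^bsub>Q\<^esub> k \<otimes>\<^bsub>Q\<^esub> ?u) \<otimes>\<^bsub>Q\<^esub> inv\<^bsub>Q\<^esub> (y [^]\<^bsub>Q\<^esub> l \<otimes>\<^bsub>Q\<^esub> ?u)"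
        unfolding Q.int_pow_diff[OF x] m n ..
      also have "\<dots> = y [^]\<^bsub>Q\<^esub> k \<otimes>\<^bsub>Q\<^esub> (?u \<otimes>\<^bsub>Q\<^esub> inv\<^bsub>Q\<^esub> ?u) \<otimes>\<^bsub>Q\<^esub> inv\<^bsub>Q\<^esub> (y [^]\<^bsub>Q\<^esub> l)"
        using y u by (simp only: Q.inv_mult_group Q.m_assoc Q.m_closed Q.inv_closed Q.int_pow_closed)
      also have "\<dots> = y [^]\<^bsub>Q\<^esub> (k - l)"
        using y u by (simp only: Q.int_pow_diff Q.r_inv Q.r_one Q.int_pow_closed)
      finally show ?thesis
        using ind unfolding mult_independent_def by fastforce
    qed
    then have "B s t \<subseteq> {n}" if "n \<in> B s t" for n
      using that by blast
    then show ?thesis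
      by (metis all_not_in_conv finite.emptyI finite.insertI finite_subset)
  qed
  then have "finite (\<Union>s \<in> S. \<Union>t \<in> S. B s t)"
    using S(1) by blast
  then obtain n where "n \<notin> (\<Union>s \<in> S. \<Union>t \<in> S. B s t)"
    using ex_new_if_finite infinite_UNIV_nat by blast
  then show ?thesis
    by (auto simp: B_def)
qed

text \<open>
  With \<open>(x - 1) a\<close> for \<open>diff x a\<close>: if \<open>(x - 1) a = (y - 1) b\<close>, then also \<open>(x\<^sup>n - 1) a = (y - 1) c\<close> for every \<open>n\<close>. For suitable \<open>n\<close>
  the support of \<open>x\<^sup>n a\<close> avoids the union \<open>T\<close> of the \<open>y\<close>-orbits meeting the support of \<open>a\<close>,
  so restricting \<open>- c\<close> to \<open>T\<close> solves \<open>a = (y - 1) d\<close>.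
\<close>

lemma diff_divisible:
  assumes x: "x \<in> carrier Q" and y: "y \<in> carrier Q" and ind: "mult_independent Q x y"
    and a: "a \<in> carrier N" and b: "b \<in> carrier N" and eq: "diff x a = diff y b"
  shows "\<exists>d \<in> carrier N. a = diff y d"
proof -
  define S where "S = {w \<in> carrier Q. a w \<noteq> \<one>\<^bsub>C\<^esub>}"
  define T where "T = {w \<in> carrier Q. \<exists>k::int. y [^]\<^bsub>Q\<^esub> k \<otimes>\<^bsub>Q\<^esub> w \<in> S}"
  have S: "finite S" "S \<subseteq> carrier Q"
    using a by (auto simp: S_def base_carrier)
  obtain n :: nat where n: "\<And>s t k::int. \<lbrakk>s \<in> S; t \<in> S\<rbrakk> \<Longrightarrow> x [^]\<^bsub>Q\<^esub> n \<otimes>\<^bsub>Q\<^esub> s \<noteq> y [^]\<^bsub>Q\<^esub> k \<otimes>\<^bsub>Q\<^esub> t"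
    using exists_escaping_power[OF x y ind S] by blast
  obtain c where c: "c \<in> carrier N" "diff (x [^]\<^bsub>Q\<^esub> n) a = diff y c"
    using diff_pow[OF x y a b eq] by blast
  have ST: "w \<in> T" if "w \<in> S" for w
    using that S Q.l_one[of w] by (auto simp: T_def intro!: exI[of _ "0::int"])
  \<comment> \<open>\<open>T\<close> is a union of \<open>y\<close>-orbits, so cutting a function
    off to \<open>T\<close> commutes with the shift by \<open>y\<close>.\<close>
  have T_shift: "inv\<^bsub>Q\<^esub> y \<otimes>\<^bsub>Q\<^esub> w \<in> T \<longleftrightarrow> w \<in> T" if w: "w \<in> carrier Q" for w
  proof -
    have "y [^]\<^bsub>Q\<^esub> k \<otimes>\<^bsub>Q\<^esub> (inv\<^bsub>Q\<^esub> y \<otimes>\<^bsub>Q\<^esub> w) = y [^]\<^bsub>Q\<^esub> (k - 1) \<otimes>\<^bsub>Q\<^esub> w" for k :: int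
      using y w by (simp add: Q.int_pow_diff Q.m_assoc)
    then have "(\<exists>k::int. y [^]\<^bsub>Q\<^esub> k \<otimes>\<^bsub>Q\<^esub> (inv\<^bsub>Q\<^esub> y \<otimes>\<^bsub>Q\<^esub> w) \<in> S) \<longleftrightarrow> (\<exists>k::int. y [^]\<^bsub>Q\<^esub> k \<otimes>\<^bsub>Q\<^esub> w \<in> S)"
      by (metis add_diff_cancel_right')
    then show ?thesis
      using y w by (simp add: T_def)
  qed
  have escape: "a (inv\<^bsub>Q\<^esub> (x [^]\<^bsub>Q\<^esub> n) \<otimes>\<^bsub>Q\<^esub> w) = \<one>\<^bsub>C\<^esub>" if wT: "w \<in> T" for w
  proof (rule ccontr)
    let ?s = "inv\<^bsub>Q\<^esub> (x [^]\<^bsub>Q\<^esub> n) \<otimes>\<^bsub>Q\<^esub> w"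
    assume "a ?s \<noteq> \<one>\<^bsub>C\<^esub>"
    then have s: "?s \<in> S"
      using wT x by (simp add: S_def T_def)
    obtain k :: int where k: "w \<in> carrier Q" "y [^]\<^bsub>Q\<^esub> k \<otimes>\<^bsub>Q\<^esub> w \<in> S"
      using wT by (auto simp: T_def)
    \<comment> \<open>Both sides equal \<open>w\<close>: a support element of \<open>a\<close> moved
      by \<open>x^n\<close>, and another moved by a power of \<open>y\<close>. The choice of
      \<open>n\<close> excludes this.\<close>
    have "x [^]\<^bsub>Q\<^esub> n \<otimes>\<^bsub>Q\<^esub> ?s = y [^]\<^bsub>Q\<^esub> (- k) \<otimes>\<^bsub>Q\<^esub> (y [^]\<^bsub>Q\<^esub> k \<otimes>\<^bsub>Q\<^esub> w)"
      using x y k(1) by (simp add: Q.int_pow_neg)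
    then show False
      using n[OF s k(2)] by blast
  qed
  \<comment> \<open>On \<open>T\<close>, additively, \<open>(x^n - 1) a = - a\<close> by
    \<open>escape\<close>, so \<open>a = (y - 1) (- c)\<close> there. Off \<open>T\<close> the
    neutral value fits, as the support of \<open>a\<close> lies in \<open>T\<close>.\<close>
  define d where "d = (\<lambda>w \<in> carrier Q. if w \<in> T then inv\<^bsub>C\<^esub> (c w) else \<one>\<^bsub>C\<^esub>)"
  have d: "d \<in> carrier N"
  proof -
    have "{w \<in> carrier Q. d w \<noteq> \<one>\<^bsub>C\<^esub>} \<subseteq> {w \<in> carrier Q. c w \<noteq> \<one>\<^bsub>C\<^esub>}"
      by (auto simp: d_def)
    moreover have "finite {w \<in> carrier Q. c w \<noteq> \<one>\<^bsub>C\<^esub>}"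
      using c(1) by (simp add: base_carrier)
    ultimately have "finite {w \<in> carrier Q. d w \<noteq> \<one>\<^bsub>C\<^esub>}"
      by (rule finite_subset)
    then show ?thesis
      using c(1) by (auto simp: base_carrier d_def)
  qed
  have "a = diff y d"
  proof (rule base_eqI[OF a diff_closed[OF y d]])
    fix w assume w: "w \<in> carrier Q"
    let ?v = "inv\<^bsub>Q\<^esub> y \<otimes>\<^bsub>Q\<^esub> w"
    have v: "?v \<in> carrier Q"
      using y w by simp
    show "a w = diff y d w"
    proof (cases "w \<in> T")
      case True
      have closed: "a w \<in> carrier C" "c w \<in> carrier C" "c ?v \<in> carrier C"
        using a c v w by simp_all
      have "inv\<^bsub>C\<^esub> a w = diff (x [^]\<^bsub>Q\<^esub> n) a w"
        using True a x w closed by (simp add: diff_apply escape)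
      also have "\<dots> = c ?v \<otimes>\<^bsub>C\<^esub> inv\<^bsub>C\<^esub> c w"
        using c y w by (simp add: diff_apply)
      finally have "a w = inv\<^bsub>C\<^esub> (c ?v \<otimes>\<^bsub>C\<^esub> inv\<^bsub>C\<^esub> c w)"
        using closed C.inv_inv by metis
      also have "\<dots> = diff y d w"
        using True T_shift[OF w] y d w v closed by (simp add: diff_apply d_def C.inv_mult)
      finally show ?thesis .
    next
      case False
      then have "a w = \<one>\<^bsub>C\<^esub>"
        using w ST by (auto simp: S_def)
      then show ?thesis
        using False T_shift[OF w] y d w v by (simp add: diff_apply d_def)
    qed
  qed
  then show ?thesis
    using d by blast
qed

section \<open>The wreath product as an extension of \<open>Q\<close> by the base group\<close>

lemma carrier_wreath: "carrier W = carrier N \<times> carrier Q"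
  by (simp add: restricted_wreath_product_def semidirect_product_def)

lemma mult_wreath: "(a, x) \<otimes>\<^bsub>W\<^esub> (b, y) = (a \<otimes>\<^bsub>N\<^esub> \<theta> x b, x \<otimes>\<^bsub>Q\<^esub> y)"
  by (simp add: restricted_wreath_product_def semidirect_product_def)

lemma one_wreath: "\<one>\<^bsub>W\<^esub> = (\<one>\<^bsub>N\<^esub>, \<one>\<^bsub>Q\<^esub>)"
  by (simp add: restricted_wreath_product_def semidirect_product_def)

lemma kernel_wreath: "kernel W Q snd = carrier N \<times> {\<one>\<^bsub>Q\<^esub>}"
  by (auto simp: kernel_def carrier_wreath)

sublocale W: abelian_by_abelian W Q snd
proof
  show "snd \<in> hom W Q"
    by (rule homI) (auto simp: carrier_wreath mult_wreath)
  show "a \<otimes>\<^bsub>W\<^esub> b = b \<otimes>\<^bsub>W\<^esub> a" if "a \<in> kernel W Q snd" "b \<in> kernel W Q snd" for a b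
    using that N.m_comm by (auto simp: kernel_wreath mult_wreath shift_one simp del: mult_sum_group)
qed

text \<open>Translates the commutators of the abstract argument into \<open>diff\<close>. The check
  is made in the form \<open>g a = c a g\<close>, which avoids computing inverses in
  \<open>W\<close>.\<close>

lemma comm_wreath:
  assumes "g \<in> carrier W" "a \<in> carrier N"
  shows "W.comm g (a, \<one>\<^bsub>Q\<^esub>) = (diff (snd g) a, \<one>\<^bsub>Q\<^esub>)"
proof -
  obtain b x where g: "g = (b, x)" "b \<in> carrier N" "x \<in> carrier Q"
    using assms(1) by (auto simp: carrier_wreath)
  let ?a = "(a, \<one>\<^bsub>Q\<^esub>)" and ?c = "(diff x a, \<one>\<^bsub>Q\<^esub>)"
  have in_W: "?a \<in> carrier W" "?c \<in> carrier W"
    using assms(2) g by (auto simp: carrier_wreath intro: diff_closed)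
  have "?c \<otimes>\<^bsub>W\<^esub> (?a \<otimes>\<^bsub>W\<^esub> g) = (diff x a \<otimes>\<^bsub>N\<^esub> (a \<otimes>\<^bsub>N\<^esub> b), x)"
    using g assms(2) diff_closed[of x a] N.m_closed[of a b]
    by (simp add: mult_wreath shift_one del: mult_sum_group)
  also have "diff x a \<otimes>\<^bsub>N\<^esub> (a \<otimes>\<^bsub>N\<^esub> b) = \<theta> x a \<otimes>\<^bsub>N\<^esub> b"
    using g assms(2) unfolding diff_def
    by (simp only: N.m_assoc N.inv_cancel_left shift_closed N.inv_closed N.m_closed)
  also have "\<dots> = b \<otimes>\<^bsub>N\<^esub> \<theta> x a"
    using g assms(2) by (intro N.m_comm shift_closed)
  also have "(b \<otimes>\<^bsub>N\<^esub> \<theta> x a, x) = g \<otimes>\<^bsub>W\<^esub> ?a"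
    using g by (simp add: mult_wreath del: mult_sum_group)
  finally have "g \<otimes>\<^bsub>W\<^esub> ?a = ?c \<otimes>\<^bsub>W\<^esub> (?a \<otimes>\<^bsub>W\<^esub> g)" ..
  then show ?thesis
    using assms(1) in_W g(1) unfolding W.comm_def
    by (simp add: W.m_assoc W.inv_solve_right' del: mult_sum_group)
qed

text \<open>Read through \<open>comm_wreath\<close>, \<open>centralizer\<close> is
  \<open>shift_fixed\<close> and \<open>comm_divisible\<close> is
  \<open>diff_divisible\<close>.\<close>

lemma no_self_similar_action:
  assumes "prime p" and pow: "\<And>c. c \<in> carrier C \<Longrightarrow> c [^]\<^bsub>C\<^esub> p = \<one>\<^bsub>C\<^esub>"
    and C: "\<not> carrier C \<subseteq> {\<one>\<^bsub>C\<^esub>}" and Q: "\<not> carrier Q \<subseteq> {\<one>\<^bsub>Q\<^esub>}"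
  shows "\<not> self_similar_action W p act sect"
proof
  assume "self_similar_action W p act sect"
  then interpret S: self_similar_action W p act sect .
  interpret self_similar_extension W Q snd p act sect
  proof
    show "prime p" by fact
    have base_pow: "(a [^]\<^bsub>N\<^esub> (n::nat)) w = a w [^]\<^bsub>C\<^esub> n" if "w \<in> carrier Q" for a n w
      by (induction n) (use that in simp_all)
    show "a [^]\<^bsub>W\<^esub> p = \<one>\<^bsub>W\<^esub>" if a: "a \<in> kernel W Q snd" for a
    proof -
      obtain b where b: "a = (b, \<one>\<^bsub>Q\<^esub>)" "b \<in> carrier N"
        using a by (auto simp: kernel_wreath)
      have "(b, \<one>\<^bsub>Q\<^esub>) [^]\<^bsub>W\<^esub> (n::nat) = (b [^]\<^bsub>N\<^esub> n, \<one>\<^bsub>Q\<^esub>)" for n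
        by (induction n)
          (use b in \<open>simp_all add: one_wreath mult_wreath shift_one del: mult_sum_group one_sum_group\<close>)
      moreover have "b [^]\<^bsub>N\<^esub> p = \<one>\<^bsub>N\<^esub>"
        using b pow by (intro base_eqI N.nat_pow_closed N.one_closed) (simp_all add: base_pow)
      ultimately show ?thesis
        by (simp add: b(1) one_wreath del: one_sum_group)
    qed
    show "\<not> kernel W Q snd \<subseteq> {\<one>\<^bsub>W\<^esub>}"
    proof -
      obtain c where c: "c \<in> carrier C" "c \<noteq> \<one>\<^bsub>C\<^esub>"
        using C by blast
      \<comment> \<open>A nontrivial base element supported at the identity alone.\<close>
      let ?a = "\<lambda>w \<in> carrier Q. if w = \<one>\<^bsub>Q\<^esub> then c else \<one>\<^bsub>C\<^esub>"
      have "?a \<in> carrier N"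
        using c by (auto simp: base_carrier)
      moreover have "?a \<noteq> \<one>\<^bsub>N\<^esub>"
        using c by (auto dest!: fun_cong[of _ _ "\<one>\<^bsub>Q\<^esub>"])
      ultimately show ?thesis
        by (auto simp: kernel_wreath one_wreath simp del: one_sum_group)
    qed
    show "\<not> carrier W \<subseteq> kernel W Q snd"
      using Q N.one_closed by (auto simp: carrier_wreath kernel_wreath simp del: one_sum_group)
    show "\<exists>h \<in> carrier W. mult_independent Q (snd g) (snd h)"
      if g: "g \<in> carrier W" "g \<notin> kernel W Q snd" for g
    proof -
      have "snd g \<in> carrier Q" "snd g \<noteq> \<one>\<^bsub>Q\<^esub>"
        using g by (auto simp: carrier_wreath kernel_wreath)
      then obtain y where y: "y \<in> carrier Q" "mult_independent Q (snd g) y"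
        using exists_independent by blast
      then show ?thesis
        using N.one_closed by (intro bexI[of _ "(\<one>\<^bsub>N\<^esub>, y)"]) (auto simp: carrier_wreath simp del: one_sum_group)
    qed
    show "a = \<one>\<^bsub>W\<^esub>"
      if g: "g \<in> carrier W" "g \<notin> kernel W Q snd" and a: "a \<in> kernel W Q snd"
        and eq: "W.comm g a = \<one>\<^bsub>W\<^esub>" for g a
    proof -
      obtain b where b: "a = (b, \<one>\<^bsub>Q\<^esub>)" "b \<in> carrier N"
        using a by (auto simp: kernel_wreath)
      have x: "snd g \<in> carrier Q" "snd g \<noteq> \<one>\<^bsub>Q\<^esub>"
        using g by (auto simp: carrier_wreath kernel_wreath)
      have "diff (snd g) b = \<one>\<^bsub>N\<^esub>"
        using eq g b by (simp add: comm_wreath one_wreath del: one_sum_group)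
      then have "\<theta> (snd g) b = b"
        using N.inv_equality[of "\<theta> (snd g) b" "inv\<^bsub>N\<^esub> b"] shift_closed[OF x(1) b(2)] b(2)
        unfolding diff_def by (metis N.inv_closed N.inv_inv)
      then show ?thesis
        using shift_fixed[OF x b(2)] b(1) one_wreath by simp
    qed
    show "\<exists>c \<in> kernel W Q snd. a = W.comm h c"
      if gh: "g \<in> carrier W" "h \<in> carrier W" and ind: "mult_independent Q (snd g) (snd h)"
        and ab: "a \<in> kernel W Q snd" "b \<in> kernel W Q snd" and eq: "W.comm g a = W.comm h b"
      for g h a b
    proof -
      obtain a' b' where a': "a = (a', \<one>\<^bsub>Q\<^esub>)" "a' \<in> carrier N" and b': "b = (b', \<one>\<^bsub>Q\<^esub>)" "b' \<in> carrier N"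
        using ab by (auto simp: kernel_wreath)
      have xy: "snd g \<in> carrier Q" "snd h \<in> carrier Q"
        using gh by (auto simp: carrier_wreath)
      have "diff (snd g) a' = diff (snd h) b'"
        using eq gh a' b' by (simp add: comm_wreath)
      then obtain d where "d \<in> carrier N" "a' = diff (snd h) d"
        using diff_divisible[OF xy ind a'(2) b'(2)] by blast
      then show ?thesis
        using gh a'(1) by (intro bexI[of _ "(d, \<one>\<^bsub>Q\<^esub>)"]) (simp_all add: comm_wreath kernel_wreath)
    qed
  qed
  show False
    by (rule no_such_action)
qed

end

text \<open>Take \<open>s\<close> in the support of \<open>h x\<close> and let \<open>y\<close>
  correspond to a different basis element \<open>t\<close>. In a relation the coordinate at
  \<open>s\<close> forces \<open>i = 0\<close>, and then the one at \<open>t\<close> forces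
  \<open>j = 0\<close>.\<close>

lemma free_Abelian_group_independent:
  assumes "group Q" and S: "2 \<le> card S" and iso: "h \<in> iso Q (free_Abelian_group S)"
    and x: "x \<in> carrier Q" "x \<noteq> \<one>\<^bsub>Q\<^esub>"
  shows "\<exists>y \<in> carrier Q. mult_independent Q x y"
proof -
  let ?F = "free_Abelian_group S"
  interpret Q: group Q by fact
  interpret h: group_hom Q ?F h
    by (rule group_hom.intro[OF \<open>group Q\<close> group_free_Abelian_group])
      (use iso in \<open>simp add: group_hom_axioms_def iso_def\<close>)
  have bij: "bij_betw h (carrier Q) (carrier ?F)"
    using iso by (simp add: iso_def)
  have keys: "Poly_Mapping.keys (h x) \<subseteq> S"
    using h.hom_closed[OF x(1)] by simp
  have "h x \<noteq> 0"
    using inj_onD[OF bij_betw_imp_inj_on[OF bij], of x "\<one>\<^bsub>Q\<^esub>"] x h.hom_one by auto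
  then obtain s where s: "s \<in> S" "Poly_Mapping.lookup (h x) s \<noteq> 0"
    using keys by (metis in_keys_iff keys_eq_empty all_not_in_conv subsetD)
  obtain t where t: "t \<in> S" "t \<noteq> s"
    using S card_mono[of "{s}" S] by fastforce
  obtain y where y: "y \<in> carrier Q" "h y = frag_of t"
    using bij t by (metis bij_betw_def imageE frag_of_in_free_Abelian_group)
  have "mult_independent Q x y"
    unfolding mult_independent_def
  proof (intro allI impI)
    fix i j :: int
    assume "x [^]\<^bsub>Q\<^esub> i = y [^]\<^bsub>Q\<^esub> j"
    then have "h x [^]\<^bsub>?F\<^esub> i = h y [^]\<^bsub>?F\<^esub> j"
      using x y by (metis h.hom_int_pow)
    then have eq: "frag_cmul i (h x) = frag_cmul j (frag_of t)"
      using keys t by (simp add: y)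
    have "i = 0"
      using arg_cong[OF eq, of "\<lambda>f. Poly_Mapping.lookup f s"] s t by (simp add: lookup_frag_of)
    moreover have "j = 0"
      using arg_cong[OF eq, of "\<lambda>f. Poly_Mapping.lookup f t"] \<open>i = 0\<close> by (simp add: lookup_frag_of)
    ultimately show "i = 0 \<and> j = 0" by simp
  qed
  then show ?thesis
    using y by blast
qed

theorem corollary1:
  fixes C :: "('a, 'b) monoid_scheme"
    and Q :: "('c, 'd) monoid_scheme"
    and S :: "'e set"
    and p d :: nat
  assumes "prime p"
    and "d \<ge> 2"
    and "group C" and "cyclic_group C" and "order C = p"
    and "group Q" and "finite S" and "card S = d" and "Q \<cong> free_Abelian_group S"
  shows "\<not> (\<exists>\<phi>. faithful_state_closed_representation p (restricted_wreath_product C Q) \<phi>)"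
proof
  assume "\<exists>\<phi>. faithful_state_closed_representation p (restricted_wreath_product C Q) \<phi>"
  then obtain \<phi> where \<phi>: "faithful_state_closed_representation p (restricted_wreath_product C Q) \<phi>"
    by blast
  obtain h where h: "h \<in> iso Q (free_Abelian_group S)"
    using assms by (auto simp: is_iso_def)
  have card: "2 \<le> card S"
    using assms by simp
  have comm_C: "comm_group C"
    using assms by (simp add: group.cyclic_imp_abelian_group)
  have comm_Q: "comm_group Q"
    using comm_group.iso_imp_comm_group[OF abelian_free_Abelian_group group.iso_sym[OF assms(6,9)]]
      group.is_monoid[OF assms(6)] .
  \<comment> \<open>Freeness and rank at least two supply the independent partners.\<close>
  interpret wreath C Q
  proof (intro wreath.intro comm_C comm_Q wreath_axioms.intro)
    show "\<exists>y \<in> carrier Q. mult_independent Q x y" if "x \<in> carrier Q" "x \<noteq> \<one>\<^bsub>Q\<^esub>" for x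
      by (rule free_Abelian_group_independent[OF assms(6) card h that])
  qed
  have "\<not> carrier C \<subseteq> {\<one>\<^bsub>C\<^esub>}"
  proof
    assume "carrier C \<subseteq> {\<one>\<^bsub>C\<^esub>}"
    then have "order C \<le> 1"
      unfolding order_def using card_mono[of "{\<one>\<^bsub>C\<^esub>}"] by fastforce
    then show False
      using assms prime_gt_1_nat[of p] by simp
  qed
  moreover have "\<not> carrier Q \<subseteq> {\<one>\<^bsub>Q\<^esub>}"
  proof
    assume Q: "carrier Q \<subseteq> {\<one>\<^bsub>Q\<^esub>}"
    \<comment> \<open>A basis element is nonzero, but here it would be the image of the
      identity.\<close>
    obtain s where "s \<in> S"
      using card by fastforce
    then have "frag_of s \<in> h ` carrier Q"
      using h by (auto simp: iso_def bij_betw_def)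
    then have "frag_of s = h \<one>\<^bsub>Q\<^esub>"
      using Q by auto
    also have "\<dots> = 0"
      using h assms(6) hom_one[of h Q "free_Abelian_group S"] by (simp add: iso_def)
    finally show False
      by simp
  qed
  moreover have "c [^]\<^bsub>C\<^esub> p = \<one>\<^bsub>C\<^esub>" if "c \<in> carrier C" for c
    using assms group.pow_order_eq_1[OF assms(3) that] by simp
  ultimately show False
    using no_self_similar_action[OF assms(1)] self_similar_action_of_representation[OF W.group_axioms \<phi>]
    by blast
qed

end
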